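(* Let $\Phi$ be a complex binary sextic form representing a set $\Gamma$ of six distinct points of $\mathbb P^1_{\mathbb C}$. Then $\Gamma$ is in ricochet configuration ($R$-configuration) if and only if $\mathbf U_6(\Phi)=\mathbf U_{10}(\Phi)=0$, where $$\mathbf U_6=4032\,I_2^3-25025\,I_2I_4+45375\,I_6,$$ $$\mathbf U_{10}=358278336\,I_2^2I_6-2772533775\,I_4I_6+6933745\,I_2I_4^2+1207483200\,I_{10},$$ and $I_2,I_4,I_6,I_{10}$ are the standard fundamental invariants of binary sextics, in degrees $2,4,6,10$, as normalised in the context.
   Context: Sextuples: a nonzero binary sextic $\prod_{i=1}^6(\alpha_i x_1-\beta_i x_2)$ represents the points $\beta_i/\alpha_i\in\mathbb P^1=\mathbb C\cup\{\infty\}$. A set of six distinct points of $\mathbb P^1$ is in $R$-configuration if its elements can be labelled $A,B,C,D,E,F$ so that for some complex number $t$ a fractional linear transformation takes them respectively to $0,\ t,\ \infty,\ 1,\ \frac{t-1}{t+1},\ -1$. Transvectants: for binary forms $P$ of degree $m$ and $Q$ of degree $n$ in $x_1,x_2$, the $r$-th transvectant is $$(P,Q)_r=\frac{(m-r)!\,(n-r)!}{m!\,n!}\sum_{i=0}^r(-1)^i\binom ri\frac{\partial^rP}{\partial x_1^{r-i}\partial x_2^{i}}\,\frac{\partial^rQ}{\partial x_1^{i}\partial x_2^{r-i}},$$ a form of degree $m+n-2r$. Invariants: for a binary sextic $\Phi$ put $i=(\Phi,\Phi)_4$ (a quartic form) and $l=(\Phi,i)_4$ (a quadratic form). Then $$I_2=(\Phi,\Phi)_6,\quad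 I_4=(i,i)_4,\quad I_6=(l,l)_2,\quad I_{10}=(\Phi,l^3)_6.$$ *)

theory Defs
  imports Complex_Main "HOL-Computational_Algebra.Polynomial"
begin

(* A polynomial in x1, x2 is an element of (C[x1])[x2]: the coefficient of x1^i x2^j in P is
   "coeff (coeff P j) i". *)
type_synonym bipoly = "complex poly poly"

definition x1 :: bipoly where "x1 = [:[:0, 1:]:]"

definition x2 :: bipoly where "x2 = [:0, 1:]"

definition scal :: "complex \<Rightarrow> bipoly \<Rightarrow> bipoly" where
  "scal c P = smult [:c:] P"

definition binary_form :: "nat \<Rightarrow> bipoly \<Rightarrow> bool" where
  "binary_form n P \<longleftrightarrow> (\<forall>i j. coeff (coeff P j) i \<noteq> 0 \<longrightarrow> i + j = n)"

definition d1 :: "bipoly \<Rightarrow> bipoly" where "d1 P = map_poly pderiv P"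

definition d2 :: "bipoly \<Rightarrow> bipoly" where "d2 P = pderiv P"

(* P and Q are regarded as forms of degrees m and n; the degrees are arguments because they cannot
   be read off when P or Q vanishes. *)
definition transvectant :: "nat \<Rightarrow> nat \<Rightarrow> nat \<Rightarrow> bipoly \<Rightarrow> bipoly \<Rightarrow> bipoly" where
  "transvectant m n r P Q =
     scal (fact (m - r) * fact (n - r) / (fact m * fact n))
       (\<Sum>i=0..r. scal ((-1) ^ i * of_nat (r choose i))
          ((d1 ^^ (r - i)) ((d2 ^^ i) P) * (d1 ^^ i) ((d2 ^^ (r - i)) Q)))"

definition cov_i :: "bipoly \<Rightarrow> bipoly" where
  "cov_i \<Phi> = transvectant 6 6 4 \<Phi> \<Phi>"

definition cov_l :: "bipoly \<Rightarrow> bipoly" where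
  "cov_l \<Phi> = transvectant 6 4 4 \<Phi> (cov_i \<Phi>)"

(* On binary sextics the following are forms of degree 0; they are kept as elements of the
   polynomial ring. *)
definition I2 :: "bipoly \<Rightarrow> bipoly" where
  "I2 \<Phi> = transvectant 6 6 6 \<Phi> \<Phi>"

definition I4 :: "bipoly \<Rightarrow> bipoly" where
  "I4 \<Phi> = transvectant 4 4 4 (cov_i \<Phi>) (cov_i \<Phi>)"

definition I6 :: "bipoly \<Rightarrow> bipoly" where
  "I6 \<Phi> = transvectant 2 2 2 (cov_l \<Phi>) (cov_l \<Phi>)"

definition I10 :: "bipoly \<Rightarrow> bipoly" where
  "I10 \<Phi> = transvectant 6 6 6 \<Phi> (cov_l \<Phi> ^ 3)"

definition U6 :: "bipoly \<Rightarrow> bipoly" where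
  "U6 \<Phi> = 4032 * I2 \<Phi> ^ 3 - 25025 * I2 \<Phi> * I4 \<Phi> + 45375 * I6 \<Phi>"

definition U10 :: "bipoly \<Rightarrow> bipoly" where
  "U10 \<Phi> = 358278336 * I2 \<Phi> ^ 2 * I6 \<Phi> - 2772533775 * I4 \<Phi> * I6 \<Phi>
     + 6933745 * I2 \<Phi> * I4 \<Phi> ^ 2 + 1207483200 * I10 \<Phi>"

(* The projective line C \<union> {\<infinity>}, with None as the point at infinity. *)
type_synonym proj_line = "complex option"

(* The point a/b of the projective line; only meaningful when (a, b) is not (0, 0). *)
definition proj_quot :: "complex \<Rightarrow> complex \<Rightarrow> proj_line" where
  "proj_quot a b = (if b = 0 then None else Some (a / b))"

definition mobius :: "complex \<Rightarrow> complex \<Rightarrow> complex \<Rightarrow> complex \<Rightarrow> proj_line \<Rightarrow> proj_line" where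
  "mobius a b c d p = (case p of
     None \<Rightarrow> proj_quot a c
   | Some z \<Rightarrow> proj_quot (a * z + b) (c * z + d))"

definition fractional_linear :: "(proj_line \<Rightarrow> proj_line) \<Rightarrow> bool" where
  "fractional_linear f \<longleftrightarrow> (\<exists>a b c d. a * d - b * c \<noteq> 0 \<and> f = mobius a b c d)"

definition represents :: "bipoly \<Rightarrow> proj_line set \<Rightarrow> bool" where
  "represents \<Phi> \<Gamma> \<longleftrightarrow> \<Phi> \<noteq> 0 \<and>
     (\<exists>\<alpha> \<beta> :: nat \<Rightarrow> complex.
        \<Phi> = (\<Prod>i=1..6. scal (\<alpha> i) x1 - scal (\<beta> i) x2) \<and>
        \<Gamma> = (\<lambda>i. proj_quot (\<beta> i) (\<alpha> i)) ` {1..6})"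

(* The point (t-1)/(t+1) is taken in the projective line, so it is infinity for t = -1 (which is
   then excluded because the six points are distinct). *)
definition R_configuration :: "proj_line set \<Rightarrow> bool" where
  "R_configuration \<Gamma> \<longleftrightarrow> card \<Gamma> = 6 \<and>
     (\<exists>A B C D E F t f. \<Gamma> = {A, B, C, D, E, F} \<and> fractional_linear f \<and>
        f A = Some 0 \<and> f B = Some t \<and> f C = None \<and> f D = Some 1 \<and>
        f E = proj_quot (t - 1) (t + 1) \<and> f F = Some (-1))"

end

(* Attach to six labelled points Joubert's coordinates: the six sums of five bracket products
   indexed by the totals of the set of points. A permutation of the points permutes the coordinates
   up to sign (through the outer automorphism of S_6, so every permutation of the coordinates
   occurs), the first and third elementary symmetric functions vanish, the second, fourth and sixth
   are polynomials in I2, I4, I6, and the fifth is a multiple of the square root of the discriminant.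
   In these coordinates the labelled ricochet condition is linear: the coordinates are
   -3u, -u and two pairs with sum 2u, where the equality of the two sums says that the four points
   0, infinity, 1, -1 form a harmonic quadruple and the remaining equation places the last point.
   The vanishing of U6 and U10 says that the symmetric functions of the coordinates are those of
   such a sextuple. So u can be recovered, -3u and -u are coordinates, and the vanishing third
   symmetric function forces the other four to pair up. *)
theory Submission
  imports Defs "HOL-Combinatorics.Permutations"
begin

section \<open>Binary forms by their coefficients\<close>

text \<open>The coefficient \<open>a k\<close> belongs to \<open>x1^(n-k) x2^k\<close>, without binomial factors.\<close>

definition form :: "nat \<Rightarrow> (nat \<Rightarrow> complex) \<Rightarrow> bipoly" where
  "form n a = (\<Sum>k\<le>n. monom (monom (a k) (n - k)) k)"

lemma coeff_form: "coeff (form n a) k = (if k \<le> n then monom (a k) (n - k) else 0)"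
  by (simp add: form_def coeff_sum)

lemma form_cong: "(\<And>k. k \<le> n \<Longrightarrow> a k = b k) \<Longrightarrow> form n a = form n b"
  by (simp add: form_def)

lemma form_0_eq_0_iff: "form 0 a = 0 \<longleftrightarrow> a 0 = 0"
  by (simp add: form_def)

lemma form_add: "form n a + form n b = form n (\<lambda>k. a k + b k)"
  by (rule poly_eqI) (simp add: coeff_form add_monom)

lemma form_diff: "form n a - form n b = form n (\<lambda>k. a k - b k)"
  by (rule poly_eqI) (simp add: coeff_form diff_monom)

lemma form_sum: "(\<Sum>i\<in>A. form n (a i)) = form n (\<lambda>k. \<Sum>i\<in>A. a i k)"
  by (rule poly_eqI) (simp add: coeff_form coeff_sum monom_sum)

lemma scal_form: "scal c (form n a) = form n (\<lambda>k. c * a k)"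
  by (rule poly_eqI) (simp add: coeff_form scal_def smult_monom)

text \<open>Coefficient functions carry arbitrary values beyond the degree, hence the cut-offs in
  the convolution.\<close>

lemma form_mult:
  "form m a * form n b =
     form (m + n) (\<lambda>k. \<Sum>i\<le>k. if i \<le> m \<and> k - i \<le> n then a i * b (k - i) else 0)"
proof (rule poly_eqI)
  fix k
  have "coeff (form m a * form n b) k =
      (\<Sum>i\<le>k. (if i \<le> m then monom (a i) (m - i) else 0) *
        (if k - i \<le> n then monom (b (k - i)) (n - (k - i)) else 0))"
    by (simp add: coeff_mult coeff_form)
  also have "\<dots> = (\<Sum>i\<le>k. monom (if i \<le> m \<and> k - i \<le> n then a i * b (k - i) else 0) (m + n - k))"
    by (intro sum.cong refl) (auto simp: mult_monom intro!: arg_cong2[where f = monom])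
  also have "\<dots> = coeff (form (m + n)
      (\<lambda>k. \<Sum>i\<le>k. if i \<le> m \<and> k - i \<le> n then a i * b (k - i) else 0)) k"
  \<comment> \<open>Above the total degree no \<open>i\<close> meets both cut-offs; up to it the
    subtraction \<open>m + n - k\<close> is not truncated.\<close>
  proof (cases "k \<le> m + n")
    case False
    then have "monom (if i \<le> m \<and> k - i \<le> n then a i * b (k - i) else 0) (m + n - k) = 0"
      if "i \<le> k" for i using that by auto
    with False show ?thesis by (simp add: coeff_form)
  qed (simp add: coeff_form monom_sum)
  finally show "coeff (form m a * form n b) k = \<dots>" .
qed

lemma d1_form: "d1 (form (Suc n) a) = form n (\<lambda>k. of_nat (Suc n - k) * a k)"
  by (rule poly_eqI) (auto
      simp: d1_def coeff_map_poly coeff_form pderiv_monom le_Suc_eq Suc_diff_le)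

lemma d2_form: "d2 (form (Suc n) a) = form n (\<lambda>k. of_nat (Suc k) * a (Suc k))"
  by (rule poly_eqI) (auto simp: d2_def coeff_pderiv coeff_form of_nat_poly smult_monom)

lemma mult_divide_cancel:
  fixes c d x y :: "'a :: field"
  shows "c \<noteq> 0 \<Longrightarrow> c * (x / (c * d) * y) = x / d * y"
  by simp

text \<open>The degree is written \<open>n + p\<close> so that the induction on \<open>p\<close> can
  raise \<open>n\<close>; the quotient of factorials is the falling factorial produced by
  \<open>p\<close> derivatives.\<close>

lemma funpow_d1_form:
  "(d1 ^^ p) (form (n + p) a) = form n (\<lambda>k. fact (n + p - k) / fact (n - k) * a k)"
proof (induction p arbitrary: n)
  case (Suc p)
  have "(d1 ^^ Suc p) (form (n + Suc p) a) = d1 ((d1 ^^ p) (form (Suc n + p) a))"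
    by simp
  also have "\<dots> = form n (\<lambda>k. fact (n + Suc p - k) / fact (n - k) * a k)"
    unfolding Suc.IH d1_form proof (rule form_cong)
    fix k assume "k \<le> n"
    then obtain j where n: "n = k + j" using le_Suc_ex by blast
    have "fact (Suc n - k) = of_nat (Suc n - k) * (fact (n - k) :: complex)"
      and "of_nat (Suc n - k) \<noteq> (0 :: complex)"
      unfolding n by (simp_all add: Suc_diff_le del: of_nat_Suc)
    then show "of_nat (Suc n - k) * (fact (Suc n + p - k) / fact (Suc n - k) * a k) =
        fact (n + Suc p - k) / fact (n - k) * a k"
      by (simp only: add_Suc add_Suc_right mult_divide_cancel not_False_eq_True)
  qed
  finally show ?case .
qed simp

lemma funpow_d2_form:
  "(d2 ^^ p) (form (n + p) a) = form n (\<lambda>k. fact (k + p) / fact k * a (k + p))"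
proof (induction p arbitrary: n)
  case (Suc p)
  have "(d2 ^^ Suc p) (form (n + Suc p) a) = d2 ((d2 ^^ p) (form (Suc n + p) a))"
    by simp
  also have "\<dots> = form n (\<lambda>k. fact (k + Suc p) / fact k * a (k + Suc p))"
    unfolding Suc.IH d2_form proof (rule form_cong)
    fix k
    show "of_nat (Suc k) * (fact (Suc k + p) / fact (Suc k) * a (Suc k + p)) =
        fact (k + Suc p) / fact k * a (k + Suc p)"
      using mult_divide_cancel[OF of_nat_neq_0[of k], of "fact (Suc k + p)" "fact k" "a (Suc k
          + p)"]
      by (simp only: fact_Suc[of k] add_Suc add_Suc_right)
  qed
  finally show ?case .
qed simp

section \<open>Derivatives and transvectants of forms in coefficients\<close>

text \<open>Two falling factorials. The one from the \<open>p\<close> derivatives in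
  \<open>x1\<close> belongs to a form of degree \<open>n - q\<close>, because \<open>x2\<close> is
  differentiated first.\<close>

definition deriv_coeff :: "nat \<Rightarrow> nat \<Rightarrow> nat \<Rightarrow> (nat \<Rightarrow> complex) \<Rightarrow> nat \<Rightarrow> complex" where
  "deriv_coeff n p q a k =
     fact (n - q - k) / fact (n - p - q - k) * (fact (k + q) / fact k) * a (k + q)"

lemma funpow_d1_d2_form:
  assumes "p + q \<le> n"
  shows "(d1 ^^ p) ((d2 ^^ q) (form n a)) = form (n - p - q) (deriv_coeff n p q a)"
proof -
  obtain r where n: "n = r + p + q" using assms le_Suc_ex[OF assms] by (auto simp: algebra_simps)
  show ?thesis
    unfolding n funpow_d2_form funpow_d1_form
    by (auto intro!: form_cong simp: deriv_coeff_def)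
qed

definition transvectant_coeff ::
  "nat \<Rightarrow> nat \<Rightarrow> nat \<Rightarrow> (nat \<Rightarrow> complex) \<Rightarrow> (nat \<Rightarrow> complex) \<Rightarrow> nat \<Rightarrow> complex" where
  "transvectant_coeff m n r a b k =
     fact (m - r) * fact (n - r) / (fact m * fact n) *
     (\<Sum>i=0..r. (-1) ^ i * of_nat (r choose i) *
        (\<Sum>j\<le>k. if j \<le> m - r \<and> k - j \<le> n - r
           then deriv_coeff m (r - i) i a j * deriv_coeff n i (r - i) b (k - j) else 0))"

lemma transvectant_form:
  assumes "r \<le> m" "r \<le> n"
  shows "transvectant m n r (form m a) (form n b) = form (m + n
      - 2 * r) (transvectant_coeff m n r a b)"
proof -
  have "(d1 ^^ (r - i)) ((d2 ^^ i) (form m a)) * (d1 ^^ i) ((d2 ^^ (r - i)) (form n b)) =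
      form (m + n - 2 * r) (\<lambda>k. \<Sum>j\<le>k. if j \<le> m - r \<and> k - j \<le> n - r
        then deriv_coeff m (r - i) i a j * deriv_coeff n i (r - i) b (k - j) else 0)"
    if "i \<in> {0..r}" for i
  proof -
    have "m - (r - i) - i = m - r" "n - i - (r - i) = n - r" "m - r + (n - r) = m + n - 2 * r"
      using that assms by auto
    then show ?thesis
      using that assms by (simp add: funpow_d1_d2_form form_mult)
  qed
  then have "transvectant m n r (form m a) (form n b) =
      scal (fact (m - r) * fact (n - r) / (fact m * fact n))
        (\<Sum>i=0..r. scal ((-1) ^ i * of_nat (r choose i))
          (form (m + n - 2 * r) (\<lambda>k. \<Sum>j\<le>k. if j \<le> m - r \<and> k - j \<le> n - r
            then deriv_coeff m (r - i) i a j * deriv_coeff n i (r - i) b (k - j) else 0)))"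
    unfolding transvectant_def by (intro arg_cong2[where f = scal] sum.cong refl) simp_all
  then show ?thesis
    by (simp add: scal_form form_sum transvectant_coeff_def[abs_def])
qed

lemma atMost_numerals: "{..Suc 0} = {0,1}" "{..2::nat} = {0,1,2}" "{..3::nat} = {0,1,2,3}"
    "{..4::nat} = {0,1,2,3,4}"
  "{0..2::nat} = {0,1,2}" "{0..4::nat} = {0,1,2,3,4}" "{0..6::nat} = {0,1,2,3,4,5,6}"
  by auto
lemma choose_numerals:
  "4 choose 2 = 6" "4 choose 3 = 4"
  "6 choose 2 = 15" "6 choose 3 = 20" "6 choose 4 = 15" "6 choose 5 = 6"
  by (simp_all add: numeral_eq_Suc)
lemmas transvectant_coeff_numerals =
  transvectant_coeff_def deriv_coeff_def atMost_numerals choose_numerals fact_numeral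
  numeral_2_eq_2[symmetric] numeral_3_eq_3[symmetric]
text \<open>This and the next four tables evaluate every transvectant that enters the invariants, so
  that only polynomial identities remain afterwards.\<close>

lemma transvectant_664:
  "transvectant_coeff 6 6 4 a a 0 = (10 * a 0 * a 4 - 5 * a 1 * a 3 + 2 * a 2 ^ 2) / 75"
  "transvectant_coeff 6 6 4 a a (Suc 0) = (50 * a 0 * a 5 - 10 * a 1 * a 4 + 2 * a 2 * a 3) / 75"
  "transvectant_coeff 6 6 4 a a 2 = (50 * a 0 * a 6 - 2 * a 2 * a 4 + a 3 ^ 2) / 25"
  "transvectant_coeff 6 6 4 a a 3 = (50 * a 1 * a 6 - 10 * a 2 * a 5 + 2 * a 3 * a 4) / 75"
  "transvectant_coeff 6 6 4 a a 4 = (10 * a 2 * a 6 - 5 * a 3 * a 5 + 2 * a 4 ^ 2) / 75"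
  by (simp_all add: transvectant_coeff_numerals field_simps power2_eq_square)

lemma transvectant_644:
  "transvectant_coeff 6 4 4 a b 0 = (60 * a 0 * b 4 - 10 * a 1 * b 3 + 4 * a 2 * b 2
      - 3 * a 3 * b 1 + 4 * a 4 * b 0) / 60"
  "transvectant_coeff 6 4 4 a b (Suc 0) = (10 * a 1 * b 4 - 4 * a 2 * b 3 + 3 * a 3 * b 2
      - 4 * a 4 * b 1 + 10 * a 5 * b 0) / 30"
  "transvectant_coeff 6 4 4 a b 2 = (4 * a 2 * b 4 - 3 * a 3 * b 3 + 4 * a 4 * b 2
      - 10 * a 5 * b 1 + 60 * a 6 * b 0) / 60"
  by (simp_all add: transvectant_coeff_numerals field_simps power2_eq_square)

lemma transvectant_666:
  "transvectant_coeff 6 6 6 a b 0 = (60 * a 0 * b 6 - 10 * a 1 * b 5 + 4 * a 2 * b 4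
      - 3 * a 3 * b 3 + 4 * a 4 * b 2 - 10 * a 5 * b 1 + 60 * a 6 * b 0) / 60"
  by (simp_all add: transvectant_coeff_numerals field_simps power2_eq_square)

lemma transvectant_444:
  "transvectant_coeff 4 4 4 a b 0 = (12 * a 0 * b 4 - 3 * a 1 * b 3 + 2 * a 2 * b 2
      - 3 * a 3 * b 1 + 12 * a 4 * b 0) / 12"
  by (simp_all add: transvectant_coeff_numerals field_simps power2_eq_square)

lemma transvectant_222:
  "transvectant_coeff 2 2 2 a b 0 = (2 * a 0 * b 2 - a 1 * b 1 + 2 * a 2 * b 0) / 2"
  by (simp_all add: transvectant_coeff_numerals field_simps power2_eq_square)

section \<open>Invariance of the transvectants\<close>

text \<open>\<open>shift_coeff\<close> and \<open>rot_coeff\<close> are the substitutions \<open>x1 := x1 + h x2\<close> and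
  \<open>(x1, x2) := (x2, - x1)\<close>, which generate the special linear group.\<close>

definition shift_coeff :: "nat \<Rightarrow> complex \<Rightarrow> (nat \<Rightarrow> complex) \<Rightarrow> nat \<Rightarrow> complex" where
  "shift_coeff n h a k = (\<Sum>j\<le>k. of_nat ((n - j) choose (k - j)) * h ^ (k - j) * a j)"

definition rot_coeff :: "nat \<Rightarrow> (nat \<Rightarrow> complex) \<Rightarrow> nat \<Rightarrow> complex" where
  "rot_coeff n a k = (-1) ^ k * a (n - k)"

lemma atMost_5_6: "{..5::nat} = {0,1,2,3,4,5}" "{..6::nat} = {0,1,2,3,4,5,6}"
  by auto

lemma choose_3_5: "3 choose 2 = 3" "5 choose 2 = 10" "5 choose 3 = 10" "5 choose 4 = 5"
  by (simp_all add: numeral_eq_Suc)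

lemma shift_coeff_6:
  "shift_coeff 6 h a 0 = a 0"
  "shift_coeff 6 h a (Suc 0) = 6 * h * a 0 + a 1"
  "shift_coeff 6 h a 2 = 15 * h^2 * a 0 + 5 * h * a 1 + a 2"
  "shift_coeff 6 h a 3 = 20 * h^3 * a 0 + 10 * h^2 * a 1 + 4 * h * a 2 + a 3"
  "shift_coeff 6 h a 4 = 15 * h^4 * a 0 + 10 * h^3 * a 1 + 6 * h^2 * a 2 + 3 * h * a 3 + a 4"
  "shift_coeff 6 h a 5 = 6 * h^5 * a 0 + 5 * h^4 * a 1 + 4 * h^3 * a 2 + 3 * h^2 * a 3
      + 2 * h * a 4 + a 5"
  "shift_coeff 6 h a 6 = h^6 * a 0 + h^5 * a 1 + h^4 * a 2 + h^3 * a 3 + h^2 * a 4 + h * a 5 + a 6"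
  by (simp_all add: shift_coeff_def atMost_numerals atMost_5_6 choose_numerals choose_3_5
      numeral_2_eq_2[symmetric] numeral_3_eq_3[symmetric])

lemma shift_coeff_4:
  "shift_coeff 4 h a 0 = a 0"
  "shift_coeff 4 h a (Suc 0) = 4 * h * a 0 + a 1"
  "shift_coeff 4 h a 2 = 6 * h^2 * a 0 + 3 * h * a 1 + a 2"
  "shift_coeff 4 h a 3 = 4 * h^3 * a 0 + 3 * h^2 * a 1 + 2 * h * a 2 + a 3"
  "shift_coeff 4 h a 4 = h^4 * a 0 + h^3 * a 1 + h^2 * a 2 + h * a 3 + a 4"
  by (simp_all add: shift_coeff_def atMost_numerals atMost_5_6 choose_numerals choose_3_5
      numeral_2_eq_2[symmetric] numeral_3_eq_3[symmetric])

lemma shift_coeff_2: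
  "shift_coeff 2 h a 0 = a 0"
  "shift_coeff 2 h a (Suc 0) = 2 * h * a 0 + a 1"
  "shift_coeff 2 h a 2 = h^2 * a 0 + h * a 1 + a 2"
  by (simp_all add: shift_coeff_def atMost_numerals numeral_2_eq_2[symmetric])

section \<open>Covariants and invariants as functions of the coefficients\<close>

definition i_coeff :: "(nat \<Rightarrow> complex) \<Rightarrow> nat \<Rightarrow> complex" where
  "i_coeff a = transvectant_coeff 6 6 4 a a"

definition l_coeff :: "(nat \<Rightarrow> complex) \<Rightarrow> nat \<Rightarrow> complex" where
  "l_coeff a = transvectant_coeff 6 4 4 a (i_coeff a)"

text \<open>Kept in the shape produced by \<open>form_mult\<close>, so that
  \<open>form_2_power3\<close> follows by unfolding.\<close>

definition square_coeff :: "(nat \<Rightarrow> complex) \<Rightarrow> nat \<Rightarrow> complex" where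
  "square_coeff l = (\<lambda>k. \<Sum>i\<le>k. if i \<le> 2 \<and> k - i \<le> 2 then l i * l (k - i) else 0)"

definition cube_coeff :: "(nat \<Rightarrow> complex) \<Rightarrow> nat \<Rightarrow> complex" where
  "cube_coeff l = (\<lambda>k. \<Sum>i\<le>k. if i \<le> 4 \<and> k - i \<le> 2 then square_coeff l i * l (k - i) else 0)"

definition inv2 :: "(nat \<Rightarrow> complex) \<Rightarrow> complex" where
  "inv2 a = transvectant_coeff 6 6 6 a a 0"

definition inv4 :: "(nat \<Rightarrow> complex) \<Rightarrow> complex" where
  "inv4 a = transvectant_coeff 4 4 4 (i_coeff a) (i_coeff a) 0"

definition inv6 :: "(nat \<Rightarrow> complex) \<Rightarrow> complex" where
  "inv6 a = transvectant_coeff 2 2 2 (l_coeff a) (l_coeff a) 0"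

definition inv10 :: "(nat \<Rightarrow> complex) \<Rightarrow> complex" where
  "inv10 a = transvectant_coeff 6 6 6 a (cube_coeff (l_coeff a)) 0"

lemma form_2_power3: "form 2 l ^ 3 = form 6 (cube_coeff l)"
  unfolding power3_eq_cube square_coeff_def cube_coeff_def by (simp add: form_mult)

lemma I_form:
  "I2 (form 6 a) = form 0 (\<lambda>_. inv2 a)" "I4 (form 6 a) = form 0 (\<lambda>_. inv4 a)"
  "I6 (form 6 a) = form 0 (\<lambda>_. inv6 a)" "I10 (form 6 a) = form 0 (\<lambda>_. inv10 a)"
  by (simp_all add: I2_def I4_def I6_def I10_def cov_l_def cov_i_def transvectant_form form_2_power3
      i_coeff_def l_coeff_def inv2_def inv4_def inv6_def inv10_def)
   (simp_all add: form_def)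

definition u6 :: "(nat \<Rightarrow> complex) \<Rightarrow> complex" where
  "u6 a = 4032 * inv2 a ^ 3 - 25025 * inv2 a * inv4 a + 45375 * inv6 a"

definition u10 :: "(nat \<Rightarrow> complex) \<Rightarrow> complex" where
  "u10 a = 358278336 * inv2 a ^ 2 * inv6 a - 2772533775 * inv4 a * inv6 a
     + 6933745 * inv2 a * inv4 a ^ 2 + 1207483200 * inv10 a"

lemma form_0_arith:
  "form 0 (\<lambda>_. c) * form 0 (\<lambda>_. d) = form 0 (\<lambda>_. c * d)"
  "form 0 (\<lambda>_. c) ^ n = form 0 (\<lambda>_. c ^ n)"
  "numeral w * form 0 (\<lambda>_. c) = form 0 (\<lambda>_. numeral w * c)"
  by (simp_all add: form_def monom_0 numeral_poly poly_const_pow)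

lemma U_form: "U6 (form 6 a) = form 0 (\<lambda>_. u6 a)" "U10 (form 6 a) = form 0 (\<lambda>_. u10 a)"
  by (simp_all add: U6_def U10_def I_form form_0_arith form_add form_diff u6_def u10_def)

lemma le_numeral_cases:
  fixes k :: nat
  shows "k \<le> 2 \<longleftrightarrow> k = 0 \<or> k = Suc 0 \<or> k = 2"
    and "k \<le> 4 \<longleftrightarrow> k = 0 \<or> k = Suc 0 \<or> k = 2 \<or> k = 3 \<or> k = 4"
    and "k \<le> 6 \<longleftrightarrow> k = 0 \<or> k = Suc 0 \<or> k = 2 \<or> k = 3 \<or> k = 4 \<or> k = 5 \<or> k = 6"
  by auto

lemma i_coeff_shift:
  "k \<le> 4 \<Longrightarrow> i_coeff (shift_coeff 6 h a) k = shift_coeff 4 h (i_coeff a) k"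
  unfolding le_numeral_cases
  by (elim disjE; erule ssubst;
      simp add: i_coeff_def transvectant_664 shift_coeff_6 shift_coeff_4; algebra?)

text \<open>Stated for any \<open>c\<close> that agrees with the shifted \<open>b\<close> up to
  degree four, which is all that \<open>i_coeff_shift\<close> provides.\<close>

lemma transvectant_644_shift:
  assumes "\<And>k. k \<le> 4 \<Longrightarrow> c k = shift_coeff 4 h b k"
  shows "k \<le> 2 \<Longrightarrow> transvectant_coeff 6 4 4 (shift_coeff 6 h a) c k =
     shift_coeff 2 h (transvectant_coeff 6 4 4 a b) k"
  unfolding le_numeral_cases
  by (elim disjE; erule ssubst;
      simp add: assms transvectant_644 shift_coeff_6 shift_coeff_4 shift_coeff_2; algebra)

lemma l_coeff_shift:
  "k \<le> 2 \<Longrightarrow> l_coeff (shift_coeff 6 h a) k = shift_coeff 2 h (l_coeff a) k"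
  by (simp add: l_coeff_def transvectant_644_shift i_coeff_shift)

lemma cube_coeff_eqs:
  "cube_coeff l 0 = l 0 ^ 3"
  "cube_coeff l (Suc 0) = 3 * l 0 ^ 2 * l 1"
  "cube_coeff l 2 = 3 * l 0 ^ 2 * l 2 + 3 * l 0 * l 1 ^ 2"
  "cube_coeff l 3 = 6 * l 0 * l 1 * l 2 + l 1 ^ 3"
  "cube_coeff l 4 = 3 * l 0 * l 2 ^ 2 + 3 * l 1 ^ 2 * l 2"
  "cube_coeff l 5 = 3 * l 1 * l 2 ^ 2"
  "cube_coeff l 6 = l 2 ^ 3"
  by (simp_all add: cube_coeff_def square_coeff_def atMost_numerals atMost_5_6
      numeral_2_eq_2[symmetric] numeral_3_eq_3[symmetric]
      power2_eq_square power3_eq_cube algebra_simps)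

lemma cube_coeff_shift:
  assumes "\<And>k. k \<le> 2 \<Longrightarrow> m k = shift_coeff 2 h l k"
  shows "k \<le> 6 \<Longrightarrow> cube_coeff m k = shift_coeff 6 h (cube_coeff l) k"
  unfolding le_numeral_cases
  by (elim disjE; erule ssubst; simp add: assms cube_coeff_eqs shift_coeff_6 shift_coeff_2; algebra)

lemma transvectant_666_shift:
  assumes "\<And>k. k \<le> 6 \<Longrightarrow> c k = shift_coeff 6 h b k"
  shows "transvectant_coeff 6 6 6 (shift_coeff 6 h a) c 0 = transvectant_coeff 6 6 6 a b 0"
  by (simp add: assms transvectant_666 shift_coeff_6; algebra)

text \<open>The shift passes through \<open>i\<close>, \<open>l\<close> and the cube of
  \<open>l\<close> in turn; a final transvectant of full order then removes it, because the
  substitution has determinant one.\<close>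

lemma inv_shift:
  "inv2 (shift_coeff 6 h a) = inv2 a"
  "inv4 (shift_coeff 6 h a) = inv4 a"
  "inv6 (shift_coeff 6 h a) = inv6 a"
  "inv10 (shift_coeff 6 h a) = inv10 a"
proof -
  show "inv2 (shift_coeff 6 h a) = inv2 a" "inv10 (shift_coeff 6 h a) = inv10 a"
    by (simp_all add: inv2_def inv10_def transvectant_666_shift cube_coeff_shift l_coeff_shift)
  show "inv4 (shift_coeff 6 h a) = inv4 a"
    by (simp add: inv4_def transvectant_444 i_coeff_shift shift_coeff_4; algebra)
  show "inv6 (shift_coeff 6 h a) = inv6 a"
    by (simp add: inv6_def transvectant_222 l_coeff_shift shift_coeff_2; algebra)
qed

lemma i_coeff_rot: "k \<le> 4 \<Longrightarrow> i_coeff (rot_coeff 6 a) k = rot_coeff 4 (i_coeff a) k"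
  unfolding le_numeral_cases
  by (elim disjE; erule ssubst; simp add: i_coeff_def transvectant_664 rot_coeff_def)

lemma l_coeff_rot: "k \<le> 2 \<Longrightarrow> l_coeff (rot_coeff 6 a) k = rot_coeff 2 (l_coeff a) k"
  unfolding le_numeral_cases
  by (elim disjE; erule ssubst;
      simp add: l_coeff_def transvectant_644 i_coeff_rot;
      (simp add: rot_coeff_def transvectant_644; algebra?)?)

lemma inv_rot:
  "inv2 (rot_coeff 6 a) = inv2 a"
  "inv4 (rot_coeff 6 a) = inv4 a"
  "inv6 (rot_coeff 6 a) = inv6 a"
  "inv10 (rot_coeff 6 a) = inv10 a"
proof -
  show "inv2 (rot_coeff 6 a) = inv2 a"
    by (simp add: inv2_def transvectant_666 rot_coeff_def)
  show "inv4 (rot_coeff 6 a) = inv4 a"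
    by (simp add: inv4_def transvectant_444 i_coeff_rot; simp add: rot_coeff_def)
  show "inv6 (rot_coeff 6 a) = inv6 a"
    by (simp add: inv6_def transvectant_222 l_coeff_rot; simp add: rot_coeff_def)
  show "inv10 (rot_coeff 6 a) = inv10 a"
    by (simp add: inv10_def transvectant_666 cube_coeff_eqs l_coeff_rot;
        simp add: rot_coeff_def; algebra)
qed

lemma u_shift: "u6 (shift_coeff 6 h a) = u6 a" "u10 (shift_coeff 6 h a) = u10 a"
  by (simp_all add: u6_def u10_def inv_shift)

lemma u_rot: "u6 (rot_coeff 6 a) = u6 a" "u10 (rot_coeff 6 a) = u10 a"
  by (simp_all add: u6_def u10_def inv_rot)

section \<open>The invariants of a sextic with roots at zero and infinity\<close>

text \<open>The left side is the fifth elementary symmetric function of the \<open>z\<close>'s. The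
  right side is, up to sign and a constant, the product of the differences of 0, \<open>r3\<close>,
  ..., \<open>r6\<close>, so it is nonzero for distinct points.\<close>

lemma sextuple_esym5:
  fixes r3 r4 r5 r6 :: complex
  assumes
    "z1 = - (r3 * r4) + r3 * r5 - r3 * r6 - r4 * r5 + r4 * r6 + r5 * r6"
    "z2 = r3 * r4 + r3 * r5 - r3 * r6 - r4 * r5 + r4 * r6 - r5 * r6"
    "z3 = - (r3 * r4) + r3 * r5 + r3 * r6 + r4 * r5 - r4 * r6 - r5 * r6"
    "z4 = - (r3 * r4) - r3 * r5 + r3 * r6 + r4 * r5 + r4 * r6 - r5 * r6"
    "z5 = r3 * r4 - r3 * r5 - r3 * r6 + r4 * r5 - r4 * r6 + r5 * r6"
    "z6 = r3 * r4 - r3 * r5 + r3 * r6 - r4 * r5 - r4 * r6 + r5 * r6"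
  shows "z1 * z2 * (z3 * z4) * (z5 + z6) + z1 * z2 * (z5 * z6) * (z3 + z4)
      + z3 * z4 * (z5 * z6) * (z1 + z2) =
    32 * (r3 * r4 * r5 * r6 *
      ((r3 - r4) * (r3 - r5) * (r3 - r6) * (r4 - r5) * (r4 - r6) * (r5 - r6)))"
  unfolding assms by algebra

text \<open>Permuting \<open>r3\<close>, ..., \<open>r6\<close> permutes the \<open>z\<close>'s up
  to a common sign, so the even symmetric functions are polynomials in \<open>e1\<close>, ...,
  \<open>e4\<close>. The fifth is alternating, hence only its square is: 1024 \<open>e4^2\<close>
  times the discriminant of the quartic with these roots.\<close>

lemma sextuple_symmetric_functions:
  fixes r3 r4 r5 r6 :: complex
  defines "e1 \<equiv> r3 + r4 + r5 + r6"
    and "e2 \<equiv> r3 * r4 + r3 * r5 + r3 * r6 + r4 * r5 + r4 * r6 + r5 * r6"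
    and "e3 \<equiv> r3 * r4 * r5 + r3 * r4 * r6 + r3 * r5 * r6 + r4 * r5 * r6"
    and "e4 \<equiv> r3 * r4 * r5 * r6"
  assumes z:
    "z1 = - (r3 * r4) + r3 * r5 - r3 * r6 - r4 * r5 + r4 * r6 + r5 * r6"
    "z2 = r3 * r4 + r3 * r5 - r3 * r6 - r4 * r5 + r4 * r6 - r5 * r6"
    "z3 = - (r3 * r4) + r3 * r5 + r3 * r6 + r4 * r5 - r4 * r6 - r5 * r6"
    "z4 = - (r3 * r4) - r3 * r5 + r3 * r6 + r4 * r5 + r4 * r6 - r5 * r6"
    "z5 = r3 * r4 - r3 * r5 - r3 * r6 + r4 * r5 - r4 * r6 + r5 * r6"
    "z6 = r3 * r4 - r3 * r5 + r3 * r6 - r4 * r5 - r4 * r6 + r5 * r6"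
  and s: "s1 = z1 + z2" "s2 = z3 + z4" "s3 = z5 + z6" "p1 = z1 * z2" "p2 = z3 * z4" "p3 = z5 * z6"
  shows "p1 + p2 + p3 + s1 * s2 + s1 * s3 + s2 * s3 = (8 * e1 * e3 - 3 * e2^2 - 20 * e4)"
    and "p1 * p2 + p1 * p3 + p2 * p3 + p1 * s2 * s3 + p2 * s1 * s3 + p3 * s1 * s2 =
        (16 * e1^2 * e2 * e4 + 16 * e1^2 * e3^2 - 16 * e1 * e2^2 * e3 - 112 * e1 * e3 * e4
        + 3 * e2^4 - 8 * e2^2 * e4 + 16 * e2 * e3^2 + 240 * e4^2)"
    and "p1 * p2 * p3 = (- 64 * e1^4 * e4^2 + 64 * e1^3 * e2 * e3 * e4 - 16 * e1^2 * e2^3 * e4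
        - 16 * e1^2 * e2^2 * e3^2 + 224 * e1^2 * e2 * e4^2 - 128 * e1^2 * e3^2 * e4
        + 8 * e1 * e2^4 * e3 - 112 * e1 * e2^2 * e3 * e4 + 64 * e1 * e2 * e3^3
        - 64 * e1 * e3 * e4^2 - e2^6 + 28 * e2^4 * e4 - 16 * e2^3 * e3^2 - 176 * e2^2 * e4^2
        + 224 * e2 * e3^2 * e4 - 64 * e3^4 + 320 * e4^3)"
    and "(p1 * p2 * s3 + p1 * p3 * s2 + p2 * p3 * s1)^2 = (- 27648 * e1^4 * e4^4
        + 18432 * e1^3 * e2 * e3 * e4^3 - 4096 * e1^3 * e3^3 * e4^2 - 4096 * e1^2 * e2^3 * e4^3
        + 1024 * e1^2 * e2^2 * e3^2 * e4^2 + 147456 * e1^2 * e2 * e4^4 - 6144 * e1^2 * e3^2 * e4^3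
        - 81920 * e1 * e2^2 * e3 * e4^3 + 18432 * e1 * e2 * e3^3 * e4^2 - 196608 * e1 * e3 * e4^4
        + 16384 * e2^4 * e4^3 - 4096 * e2^3 * e3^2 * e4^2 - 131072 * e2^2 * e4^4
        + 147456 * e2 * e3^2 * e4^3 - 27648 * e3^4 * e4^2 + 262144 * e4^5)"
  subgoal unfolding s z e1_def e2_def e3_def e4_def by algebra
  subgoal unfolding s z e1_def e2_def e3_def e4_def by algebra
  subgoal unfolding s z e1_def e2_def e3_def e4_def by algebra
  \<comment> \<open>Inserting the factorised form first spares expanding the square of the
    sum.\<close>
  subgoal unfolding s sextuple_esym5[OF z] e1_def e2_def e3_def e4_def by algebra
  done

text \<open>The hypotheses describe \<open>x1 * x2\<close> times the monic quartic whose roots have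
  elementary symmetric functions \<open>e1\<close>, ..., \<open>e4\<close>: two of the six points
  are 0 and infinity.\<close>

lemma i_coeff_normal:
  assumes a: "a 0 = 0" "a (Suc 0) = 1" "a 2 = - e1" "a 3 = e2" "a 4 = - e3" "a 5 = e4" "a 6 = 0"
  shows "i_coeff a 0 = (2 * e1^2 - 5 * e2) / 75"
    and "i_coeff a (Suc 0) = (- 2 * e1 * e2 + 10 * e3) / 75"
    and "i_coeff a 2 = (- 2 * e1 * e3 + e2^2) / 25"
    and "i_coeff a 3 = (10 * e1 * e4 - 2 * e2 * e3) / 75"
    and "i_coeff a 4 = (- 5 * e2 * e4 + 2 * e3^2) / 75"
  by (simp_all only: i_coeff_def transvectant_664 a One_nat_def; algebra)+

lemma l_coeff_normal:
  assumes a: "a 0 = 0" "a (Suc 0) = 1" "a 2 = - e1" "a 3 = e2" "a 4 = - e3" "a 5 = e4" "a 6 = 0"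
  shows "l_coeff a 0 = (8 * e1^2 * e3 - 3 * e1 * e2^2 - 50 * e1 * e4 + 5 * e2 * e3) / 2250"
    and "l_coeff a (Suc 0) = (60 * e1^2 * e4 - 34 * e1 * e2 * e3 + 9 * e2^3 - 100 * e2 * e4
        + 60 * e3^2) / 2250"
    and "l_coeff a 2 = (5 * e1 * e2 * e4 + 8 * e1 * e3^2 - 3 * e2^2 * e3 - 50 * e3 * e4) / 2250"
  by (simp_all only: l_coeff_def transvectant_644 a i_coeff_normal[OF a] One_nat_def; algebra)+

lemma inv_normal:
  assumes a: "a 0 = 0" "a (Suc 0) = 1" "a 2 = - e1" "a 3 = e2" "a 4 = - e3" "a 5 = e4" "a 6 = 0"
  shows "inv2 a = (8 * e1 * e3 - 3 * e2^2 - 20 * e4) / 60"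
    and "inv4 a = (- 20 * e1^2 * e2 * e4 + 28 * e1^2 * e3^2 - 16 * e1 * e2^2 * e3
        - 100 * e1 * e3 * e4 + 3 * e2^4 + 100 * e2^2 * e4 - 20 * e2 * e3^2) / 11250"
    and "inv6 a = (- 3600 * e1^4 * e4^2 + 4240 * e1^3 * e2 * e3 * e4 + 256 * e1^3 * e3^3
        - 1140 * e1^2 * e2^3 * e4 - 1348 * e1^2 * e2^2 * e3^2 + 11000 * e1^2 * e2 * e4^2
        - 10400 * e1^2 * e3^2 * e4 + 648 * e1 * e2^4 * e3 - 5500 * e1 * e2^2 * e3 * e4
        + 4240 * e1 * e2 * e3^3 + 10000 * e1 * e3 * e4^2 - 81 * e2^6 + 1800 * e2^4 * e4
        - 1140 * e2^3 * e3^2 - 10000 * e2^2 * e4^2 + 11000 * e2 * e3^2 * e4 - 3600 * e3^4)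
        / 10125000"
    and "inv10 a = (- 288000 * e1^6 * e2 * e4^3 - 268800 * e1^6 * e3^2 * e4^2
        + 548800 * e1^5 * e2^2 * e3 * e4^2 + 256000 * e1^5 * e2 * e3^3 * e4 - 4096 * e1^5 * e3^5
        + 1920000 * e1^5 * e3 * e4^3 - 118500 * e1^4 * e2^4 * e4^2
        - 392000 * e1^4 * e2^3 * e3^2 * e4 - 56320 * e1^4 * e2^2 * e3^4
        + 1220000 * e1^4 * e2^2 * e4^3 - 1696000 * e1^4 * e2 * e3^2 * e4^2
        - 460800 * e1^4 * e3^4 * e4 - 1500000 * e1^4 * e4^4 + 146700 * e1^3 * e2^5 * e3 * e4
        + 91240 * e1^3 * e2^4 * e3^3 - 1208000 * e1^3 * e2^3 * e3 * e4^2
        + 995200 * e1^3 * e2^2 * e3^3 * e4 + 256000 * e1^3 * e2 * e3^5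
        - 5200000 * e1^3 * e2 * e3 * e4^3 + 3360000 * e1^3 * e3^3 * e4^2
        - 16200 * e1^2 * e2^7 * e4 - 46440 * e1^2 * e2^6 * e3^2 + 344250 * e1^2 * e2^5 * e4^2
        + 200700 * e1^2 * e2^4 * e3^2 * e4 - 392000 * e1^2 * e2^3 * e3^4
        - 2050000 * e1^2 * e2^3 * e4^3 + 4560000 * e1^2 * e2^2 * e3^2 * e4^2
        - 1696000 * e1^2 * e2 * e3^4 * e4 + 2500000 * e1^2 * e2 * e4^4 - 268800 * e1^2 * e3^6
        - 2000000 * e1^2 * e3^2 * e4^3 + 9720 * e1 * e2^8 * e3 - 201150 * e1 * e2^6 * e3 * e4
        + 146700 * e1 * e2^5 * e3^3 + 630000 * e1 * e2^4 * e3 * e4^2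
        - 1208000 * e1 * e2^3 * e3^3 * e4 + 548800 * e1 * e2^2 * e3^5
        + 4500000 * e1 * e2^2 * e3 * e4^3 - 5200000 * e1 * e2 * e3^3 * e4^2
        + 1920000 * e1 * e3^5 * e4 - 729 * e2^10 + 24300 * e2^8 * e4 - 16200 * e2^7 * e3^2
        - 270000 * e2^6 * e4^2 + 344250 * e2^5 * e3^2 * e4 - 118500 * e2^4 * e3^4
        + 1000000 * e2^4 * e4^3 - 2050000 * e2^3 * e3^2 * e4^2 + 1220000 * e2^2 * e3^4 * e4
        - 288000 * e2 * e3^6 + 2500000 * e2 * e3^2 * e4^3 - 1500000 * e3^4 * e4^2) / 227812500000"
  subgoal by (simp only: inv2_def transvectant_666 a One_nat_def; algebra)
  subgoal by (simp only: inv4_def transvectant_444 i_coeff_normal[OF a] One_nat_def; algebra)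
  subgoal by (simp only: inv6_def transvectant_222 l_coeff_normal[OF a] One_nat_def; algebra)
  subgoal proof -
    \<comment> \<open>The factor 2250 clears the denominators of \<open>l\<close>, and 683437500000
      is 60 * 2250^3. Expanding the cube in \<open>m0\<close>, \<open>m1\<close>, \<open>m2\<close>
      before substituting the \<open>e\<close>'s keeps the identity tractable.\<close>
    define m0 m1 m2 where m: "m0 = 2250 * l_coeff a 0" "m1 = 2250 * l_coeff a (Suc 0)"
        "m2 = 2250 * l_coeff a 2"
    have h1: "inv10 a = (- 30 * m1 * m2^2 - 12 * e1 * (m0 * m2^2 + m1^2 * m2)
        - 3 * e2 * (6 * m0 * m1 * m2 + m1^3)
        - 12 * e3 * (m0^2 * m2 + m0 * m1^2) - 30 * e4 * m0^2 * m1) / 683437500000"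
      unfolding m by (simp only: inv10_def transvectant_666 cube_coeff_eqs a One_nat_def; algebra)
    have h2: "m0 = (8 * e1^2 * e3 - 3 * e1 * e2^2 - 50 * e1 * e4 + 5 * e2 * e3)"
      "m1 = (60 * e1^2 * e4 - 34 * e1 * e2 * e3 + 9 * e2^3 - 100 * e2 * e4 + 60 * e3^2)"
      "m2 = (5 * e1 * e2 * e4 + 8 * e1 * e3^2 - 3 * e2^2 * e3 - 50 * e3 * e4)"
      by (simp_all add: m l_coeff_normal[OF a])
    show ?thesis
      unfolding h1 h2 by algebra
  qed
  done

text \<open>\<open>c2\<close>, \<open>c4\<close>, \<open>c6\<close>, \<open>c5\<close> are the
  symmetric functions of the doubled \<open>z\<close>'s, whence the factors 4, 16, 64 and, for the
  square, 1024. The invariant of degree ten takes its simple form only modulo the one of degree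
  six.\<close>

lemma u_normal:
  assumes a: "a 0 = 0" "a (Suc 0) = 1" "a 2 = - e1" "a 3 = e2" "a 4 = - e3" "a 5 = e4" "a 6 = 0"
    and c: "c2 = (32 * e1 * e3 - 12 * e2^2 - 80 * e4)"
      "c4 = (256 * e1^2 * e2 * e4
        + 256 * e1^2 * e3^2 - 256 * e1 * e2^2 * e3 - 1792 * e1 * e3 * e4 + 48 * e2^4
        - 128 * e2^2 * e4 + 256 * e2 * e3^2 + 3840 * e4^2)"
      "c6 = (- 4096 * e1^4 * e4^2
        + 4096 * e1^3 * e2 * e3 * e4 - 1024 * e1^2 * e2^3 * e4 - 1024 * e1^2 * e2^2 * e3^2
        + 14336 * e1^2 * e2 * e4^2 - 8192 * e1^2 * e3^2 * e4 + 512 * e1 * e2^4 * e3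
        - 7168 * e1 * e2^2 * e3 * e4 + 4096 * e1 * e2 * e3^3 - 4096 * e1 * e3 * e4^2 - 64 * e2^6
        + 1792 * e2^4 * e4 - 1024 * e2^3 * e3^2 - 11264 * e2^2 * e4^2 + 14336 * e2 * e3^2 * e4
        - 4096 * e3^4 + 20480 * e4^3)"
      "c5 ^ 2 = (- 28311552 * e1^4 * e4^4 + 18874368 * e1^3 * e2 * e3 * e4^3
          - 4194304 * e1^3 * e3^3 * e4^2 - 4194304 * e1^2 * e2^3 * e4^3
          + 1048576 * e1^2 * e2^2 * e3^2 * e4^2 + 150994944 * e1^2 * e2 * e4^4
          - 6291456 * e1^2 * e3^2 * e4^3 - 83886080 * e1 * e2^2 * e3 * e4^3
          + 18874368 * e1 * e2 * e3^3 * e4^2 - 201326592 * e1 * e3 * e4^4 + 16777216 * e2^4 * e4^3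
          - 4194304 * e2^3 * e3^2 * e4^2 - 134217728 * e2^2 * e4^4 + 150994944 * e2 * e3^2 * e4^3
          - 28311552 * e3^4 * e4^2 + 268435456 * e4^5)"
  shows "u6 a = (121 * c6 - 6 * c2 ^ 3 + 33 * c2 * c4) / 30720"
    and "u10 a = - 7 / 2230272000 * (161051 * c5 ^ 2 + c2 * (76 * c2 ^ 2 - 484 * c4) ^ 2)
      + (6287879 / 243302400000 * c4 - 17957197 / 4460544000000 * c2 ^ 2)
        * (121 * c6 - 6 * c2 ^ 3 + 33 * c2 * c4)"
  subgoal by (simp only: u6_def inv_normal[OF a] c; algebra)
  subgoal by (simp only: u10_def inv_normal[OF a] c; algebra)
  done

section \<open>Joubert coordinates of six points\<close>

fun lin_coeff :: "(nat \<Rightarrow> complex) \<Rightarrow> (nat \<Rightarrow> complex) \<Rightarrow> nat \<Rightarrow> nat \<Rightarrow> complex" where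
  "lin_coeff \<alpha> \<beta> 0 k = (if k = 0 then 1 else 0)"
| "lin_coeff \<alpha> \<beta> (Suc n) k =
     \<alpha> (Suc n) * lin_coeff \<alpha> \<beta> n k - (case k of 0 \<Rightarrow> 0 | Suc j \<Rightarrow> \<beta> (Suc n) * lin_coeff \<alpha> \<beta> n j)"

lemma lin_coeff_numeral [simp]:
  "lin_coeff \<alpha> \<beta> (numeral n) k =
     \<alpha> (numeral n) * lin_coeff \<alpha> \<beta> (pred_numeral n) k
     - (case k of 0 \<Rightarrow> 0 | Suc j \<Rightarrow> \<beta> (numeral n) * lin_coeff \<alpha> \<beta> (pred_numeral n) j)"
  unfolding numeral_eq_Suc lin_coeff.simps by (rule refl)

lemma lin_coeff_eq_0: "n < k \<Longrightarrow> lin_coeff \<alpha> \<beta> n k = 0"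
  by (induction n arbitrary: k) (auto split: nat.split)

lemma scal_x1_x2: "scal c x1 - scal d x2 = [:[:0, c:], [:- d:]:]"
  by (simp add: scal_def x1_def x2_def)

lemma prod_linear_form:
  "(\<Prod>i=1..n. scal (\<alpha> i) x1 - scal (\<beta> i) x2) = form n (lin_coeff \<alpha> \<beta> n)"
proof (induction n)
  case 0
  show ?case by (simp add: form_def monom_0 one_pCons)
next
  case (Suc n)
  have "(\<Prod>i=1..Suc n. scal (\<alpha> i) x1 - scal (\<beta> i) x2) =
      (scal (\<alpha> (Suc n)) x1 - scal (\<beta> (Suc n)) x2) * form n (lin_coeff \<alpha> \<beta> n)"
    using Suc.IH by (simp add: mult.commute)
  also have "\<dots> = form (Suc n) (lin_coeff \<alpha> \<beta> (Suc n))"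
  proof (rule poly_eqI)
    fix k
    have lin: "[:0, c:] * monom d m = monom (c * d) (Suc m)" for c d :: complex and m
      by (simp add: monom_Suc smult_monom)
    have mon: "monom d (n - j) = pCons 0 (monom d (n - Suc j))" if "Suc j \<le> n"
        for d :: complex and j
      using that by (metis Suc_diff_Suc Suc_le_lessD monom_Suc)
    show "coeff ((scal (\<alpha> (Suc n)) x1 - scal (\<beta> (Suc n)) x2) * form n (lin_coeff \<alpha> \<beta> n)) k =
        coeff (form (Suc n) (lin_coeff \<alpha> \<beta> (Suc n))) k"
      unfolding scal_x1_x2
      by (cases k) (auto simp: coeff_form lin smult_monom Suc_diff_le not_le lin_coeff_eq_0
          le_Suc_eq mon monom_Suc diff_monom minus_monom)
  qed
  finally show ?case .
qed

text \<open>Putting \<open>x1 + h x2\<close> for \<open>x1\<close> in a linear factor replaces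
  \<beta> by \<open>\<beta> - h * \<alpha>\<close>: the points are translated by
  \<open>- h\<close>.\<close>

lemma lin_coeff_shift:
  "k \<le> 6 \<Longrightarrow> lin_coeff \<alpha> (\<lambda>i. \<beta> i - h * \<alpha> i) 6 k = shift_coeff 6 h (lin_coeff \<alpha> \<beta> 6) k"
  unfolding le_numeral_cases
  by (elim disjE; erule ssubst; simp add: shift_coeff_6; algebra?)

text \<open>On the points this substitution is z -> -1/z, which exchanges 0 and infinity.\<close>

lemma lin_coeff_rot:
  "k \<le> 6 \<Longrightarrow> lin_coeff \<beta> (\<lambda>i. - \<alpha> i) 6 k = rot_coeff 6 (lin_coeff \<alpha> \<beta> 6) k"
  unfolding le_numeral_cases
  by (elim disjE; erule ssubst; simp add: rot_coeff_def; algebra?)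

text \<open>The invariants are read off from the form, which sees only the first seven
  coefficients.\<close>

lemma u_cong:
  assumes "\<And>k. k \<le> 6 \<Longrightarrow> a k = b k"
  shows "u6 a = u6 b" "u10 a = u10 b"
proof -
  have "form 6 a = form 6 b" using assms by (rule form_cong)
  then have "form 0 (\<lambda>_. u6 a) = form 0 (\<lambda>_. u6 b)" "form 0 (\<lambda>_. u10 a) = form 0 (\<lambda>_. u10 b)"
    by (simp_all flip: U_form)
  then show "u6 a = u6 b" "u10 a = u10 b"
    by (simp_all add: form_def monom_0)
qed

lemma transvectant_coeff_scale:
  "transvectant_coeff m n r (\<lambda>k. c * a k) (\<lambda>k. d * b k) =
      (\<lambda>k. c * d * transvectant_coeff m n r a b k)"
proof
  fix k
  have *: "(if P then c * x * (d * y) else 0) = c * d * (if P then x * y else 0)"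
      for P and x y :: complex
    by simp
  have "deriv_coeff n p q (\<lambda>k. c * a k) k = c * deriv_coeff n p q a k" for n p q c a k
    by (simp add: deriv_coeff_def)
  then show
      "transvectant_coeff m n r (\<lambda>k. c * a k) (\<lambda>k. d * b k) k = c * d * transvectant_coeff m n r a b k"
    unfolding transvectant_coeff_def
    by (simp only: * sum_distrib_left[symmetric] mult.left_commute[of _ "c * d"])
qed

lemma u_scale: "u6 (\<lambda>k. c * a k) = c ^ 6 * u6 a" "u10 (\<lambda>k. c * a k) = c ^ 10 * u10 a"
proof -
  have i: "i_coeff (\<lambda>k. c * a k) = (\<lambda>k. c^2 * i_coeff a k)"
    by (simp add: i_coeff_def transvectant_coeff_scale power2_eq_square)
  have l: "l_coeff (\<lambda>k. c * a k) = (\<lambda>k. c^3 * l_coeff a k)"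
    unfolding l_coeff_def i transvectant_coeff_scale
    by (simp add: fun_eq_iff power2_eq_square power3_eq_cube)
  have "inv2 (\<lambda>k. c * a k) = c^2 * inv2 a" "inv4 (\<lambda>k. c * a k) = c^4 * inv4 a"
    "inv6 (\<lambda>k. c * a k) = c^6 * inv6 a"
    unfolding inv2_def inv4_def inv6_def i l transvectant_coeff_scale by algebra+
  moreover have "inv10 (\<lambda>k. c * a k) = c^10 * inv10 a"
    by (simp add: inv10_def l transvectant_666 cube_coeff_eqs; algebra)
  ultimately show "u6 (\<lambda>k. c * a k) = c ^ 6 * u6 a" "u10 (\<lambda>k. c * a k) = c ^ 10 * u10 a"
    unfolding u6_def u10_def by algebra+
qed

text \<open>The homogeneous difference of two points: for nonzero pairs it vanishes exactly when the
  points coincide.\<close>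

definition bracket :: "(nat \<Rightarrow> complex) \<Rightarrow> (nat \<Rightarrow> complex) \<Rightarrow> nat \<Rightarrow> nat \<Rightarrow> complex" where
  "bracket \<alpha> \<beta> i j = \<alpha> i * \<beta> j - \<beta> i * \<alpha> j"

text \<open>The fifteen ways of splitting the six points into three pairs form six totals of five disjoint
  splittings; coordinate \<open>k\<close> sums the bracket monomials of the \<open>k\<close>-th total. The signs make a
  permutation of the points act, up to a sign, by its image under the outer automorphism of \<open>S\<^sub>6\<close>.\<close>

definition joubert :: "(nat \<Rightarrow> complex) \<Rightarrow> (nat \<Rightarrow> complex) \<Rightarrow> nat \<Rightarrow> complex" where
  "joubert \<alpha> \<beta> k = (let d = bracket \<alpha> \<beta> in
     if k = 1 then d 1 2 * d 3 4 * d 5 6 + d 1 3 * d 2 5 * d 4 6 + d 1 4 * d 2 6 * d 3 5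
         + d 1 5 * d 2 4 * d 3 6 + d 1 6 * d 2 3 * d 4 5
     else if k = 2 then d 1 2 * d 3 4 * d 5 6 - d 1 3 * d 2 6 * d 4 5 - d 1 4 * d 2 5 * d 3 6
         - d 1 5 * d 2 3 * d 4 6 - d 1 6 * d 2 4 * d 3 5
     else if k = 3 then - d 1 2 * d 3 5 * d 4 6 - d 1 3 * d 2 4 * d 5 6 - d 1 4 * d 2 5 * d 3 6
         - d 1 5 * d 2 6 * d 3 4 + d 1 6 * d 2 3 * d 4 5
     else if k = 4 then - d 1 2 * d 3 5 * d 4 6 - d 1 3 * d 2 6 * d 4 5 + d 1 4 * d 2 3 * d 5 6
         + d 1 5 * d 2 4 * d 3 6 + d 1 6 * d 2 5 * d 3 4
     else if k = 5 then d 1 2 * d 3 6 * d 4 5 - d 1 3 * d 2 4 * d 5 6 + d 1 4 * d 2 6 * d 3 5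
         - d 1 5 * d 2 3 * d 4 6 + d 1 6 * d 2 5 * d 3 4
     else d 1 2 * d 3 6 * d 4 5 + d 1 3 * d 2 5 * d 4 6 + d 1 4 * d 2 3 * d 5 6
         - d 1 5 * d 2 6 * d 3 4 - d 1 6 * d 2 4 * d 3 5)"

lemma bracket_shift: "bracket \<alpha> (\<lambda>i. \<beta> i - h * \<alpha> i) = bracket \<alpha> \<beta>"
  by (simp add: bracket_def fun_eq_iff algebra_simps)

lemma bracket_rot: "bracket \<beta> (\<lambda>i. - \<alpha> i) = bracket \<alpha> \<beta>"
  by (simp add: bracket_def fun_eq_iff algebra_simps)

lemma joubert_cong: "bracket \<alpha> \<beta> = bracket \<gamma> \<delta> \<Longrightarrow> joubert \<alpha> \<beta> = joubert \<gamma> \<delta>"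
  unfolding joubert_def by simp

section \<open>Symmetric functions of the coordinates and their link to the invariants\<close>

text \<open>Read off from a product of linear forms, so that symmetry will follow by permuting the
  factors.\<close>

definition esym :: "(nat \<Rightarrow> complex) \<Rightarrow> nat \<Rightarrow> complex" where
  "esym x k = (-1) ^ k * lin_coeff (\<lambda>_. 1) x 6 k"

lemma esym_scale: "k \<le> 6 \<Longrightarrow> esym (\<lambda>i. c * x i) k = c ^ k * esym x k"
  unfolding le_numeral_cases esym_def
  by (elim disjE; erule ssubst; simp; algebra?)

lemma esym_pairs:
  assumes "s1 = x 1 + x 2" "s2 = x 3 + x 4" "s3 = x 5 + x 6"
    and "p1 = x 1 * x 2" "p2 = x 3 * x 4" "p3 = x 5 * x 6"
  shows "esym x (Suc 0) = s1 + s2 + s3"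
    and "esym x 2 = p1 + p2 + p3 + s1 * s2 + s1 * s3 + s2 * s3"
    and "esym x 3 = p1 * (s2 + s3) + p2 * (s1 + s3) + p3 * (s1 + s2) + s1 * s2 * s3"
    and "esym x 4 = p1 * p2 + p1 * p3 + p2 * p3 + p1 * s2 * s3 + p2 * s1 * s3 + p3 * s1 * s2"
    and "esym x 5 = p1 * p2 * s3 + p1 * p3 * s2 + p2 * p3 * s1"
    and "esym x 6 = p1 * p2 * p3"
  unfolding assms esym_def by (simp_all, algebra+)

lemma esym_cong: "(\<And>i. 1 \<le> i \<Longrightarrow> i \<le> 6 \<Longrightarrow> x i = y i) \<Longrightarrow> k \<le> 6 \<Longrightarrow> esym x k = esym y k"
  unfolding le_numeral_cases esym_def
  by (elim disjE; erule ssubst; simp)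

text \<open>\<open>rel6\<close> and \<open>rel10\<close> result from eliminating \<open>u\<close> and \<open>p\<close> from the coefficients of
  \<open>(T + 3u) (T + u) (T^2 - 2uT + p) (T^2 - 2uT - 2u^2 - p)\<close>.\<close>

definition rel6 :: "(nat \<Rightarrow> complex) \<Rightarrow> complex" where
  "rel6 x = 121 * esym x 6 - 6 * esym x 2 ^ 3 + 33 * esym x 2 * esym x 4"

definition rel10 :: "(nat \<Rightarrow> complex) \<Rightarrow> complex" where
  "rel10 x = 161051 * esym x 5 ^ 2 + esym x 2 * (76 * esym x 2 ^ 2 - 484 * esym x 4) ^ 2"

text \<open>The whole link between a sextic and its Joubert coordinates, bundled so that it can be
  proved in normal position and transported. The last two clauses have the form of
  \<open>u_normal\<close>.\<close>

definition joubert_relations :: "(nat \<Rightarrow> complex) \<Rightarrow> (nat \<Rightarrow> complex) \<Rightarrow> bool" where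
  "joubert_relations a x \<longleftrightarrow>
     esym x 1 = 0 \<and> esym x 3 = 0 \<and> esym x 5 \<noteq> 0 \<and>
     u6 a = rel6 x / 30720 \<and>
     u10 a = - 7 / 2230272000 * rel10 x
      + (6287879 / 243302400000 * esym x 4 - 17957197 / 4460544000000 * esym x 2 ^ 2) * rel6 x"

text \<open>Both sides of each relation have the same degree, one in the coefficients and the other
  in the coordinates.\<close>

lemma joubert_relations_scale:
  assumes "c \<noteq> 0" "joubert_relations a x"
  shows "joubert_relations (\<lambda>k. c * a k) (\<lambda>i. c * x i)"
proof -
  have r: "rel6 (\<lambda>i. c * x i) = c ^ 6 * rel6 x" "rel10 (\<lambda>i. c * x i) = c ^ 10 * rel10 x"
    unfolding rel6_def rel10_def by (simp_all add: esym_scale, algebra+)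
  have e: "esym (\<lambda>i. c * x i) 1 = c * esym x 1" "esym (\<lambda>i. c * x i) 2 = c^2 * esym x 2"
    "esym (\<lambda>i. c * x i) 3 = c^3 * esym x 3" "esym (\<lambda>i. c * x i) 4 = c^4 * esym x 4"
    "esym (\<lambda>i. c * x i) 5 = c^5 * esym x 5"
    by (simp_all only: esym_scale) simp_all
  from assms(2) have x: "esym x 1 = 0" "esym x 3 = 0" "esym x 5 \<noteq> 0" "u6 a = rel6 x / 30720"
    "u10 a = - 7 / 2230272000 * rel10 x
      + (6287879 / 243302400000 * esym x 4 - 17957197 / 4460544000000 * esym x 2 ^ 2) * rel6 x"
    by (simp_all add: joubert_relations_def)
  show ?thesis
    unfolding joubert_relations_def u_scale e r x
    using \<open>c \<noteq> 0\<close> x(3) by (intro conjI; (simp; fail)?; algebra)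
qed

lemma joubert_relations_cong:
  assumes "joubert_relations a x" "\<And>k. k \<le> 6 \<Longrightarrow> b k = a k" "\<And>i. 1 \<le> i \<Longrightarrow> i \<le> 6 \<Longrightarrow> y i = x i"
  shows "joubert_relations b y"
  using assms(1) u_cong[of b a, OF assms(2)] esym_cong[of y x, OF assms(3)]
  by (simp add: joubert_relations_def rel6_def rel10_def)

text \<open>The first point is infinity and the second is 0, so up to a common factor the sextic is
  the one of \<open>u_normal\<close> and the coordinates are the doubled \<open>z\<close>'s.\<close>

lemma joubert_relations_pencil:
  assumes "\<alpha> 1 = 0" "\<beta> 2 = 0"
    and nz: "\<And>i j. i \<in> {1..6} \<Longrightarrow> j \<in> {1..6} \<Longrightarrow> i \<noteq> j \<Longrightarrow> bracket \<alpha> \<beta> i j \<noteq> 0"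
  shows "joubert_relations (lin_coeff \<alpha> \<beta> 6) (joubert \<alpha> \<beta>)"
proof -
  have ab: "\<alpha> (Suc 0) = 0" "\<beta> 2 = 0" using assms by simp_all
  have "\<beta> (Suc 0) \<noteq> 0" "\<alpha> 2 \<noteq> 0" "\<alpha> 3 \<noteq> 0" "\<alpha> 4 \<noteq> 0" "\<alpha> 5 \<noteq> 0" "\<alpha> 6 \<noteq> 0"
    using nz[of 1 2] nz[of 1 3] nz[of 1 4] nz[of 1 5] nz[of 1 6] by (auto simp: bracket_def ab)
  then obtain r3 r4 r5 r6 where b: "\<beta> 3 = r3 * \<alpha> 3" "\<beta> 4 = r4 * \<alpha> 4" "\<beta> 5 = r5 * \<alpha> 5"
      "\<beta> 6 = r6 * \<alpha> 6"
    by (metis nonzero_divide_eq_eq)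
  \<comment> \<open>The product of the leading coefficients of the six linear factors, the first
    factor being \<open>- \<beta> 1\<close> times \<open>x2\<close> and the second
    \<open>\<alpha> 2\<close> times \<open>x1\<close>.\<close>
  define c where "c = - \<beta> (Suc 0) * \<alpha> 2 * \<alpha> 3 * \<alpha> 4 * \<alpha> 5 * \<alpha> 6"
  have c0: "c \<noteq> 0" by (simp add: c_def)
    (use \<open>\<beta> (Suc 0) \<noteq> 0\<close> \<open>\<alpha> 2 \<noteq> 0\<close> \<open>\<alpha> 3 \<noteq> 0\<close> \<open>\<alpha> 4 \<noteq> 0\<close>
      \<open>\<alpha> 5 \<noteq> 0\<close> \<open>\<alpha> 6 \<noteq> 0\<close> in simp)
  have r: "r3 \<noteq> 0" "r4 \<noteq> 0" "r5 \<noteq> 0" "r6 \<noteq> 0" "r3 \<noteq> r4" "r3 \<noteq> r5" "r3 \<noteq> r6" "r4 \<noteq> r5" "r4 \<noteq> r6"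
      "r5 \<noteq> r6"
    using nz[of 2 3] nz[of 2 4] nz[of 2 5] nz[of 2 6] nz[of 3 4] nz[of 3 5] nz[of 3 6] nz[of 4 5]
        nz[of 4 6] nz[of 5 6]
    by (auto simp: bracket_def ab b)
  define e1 e2 e3 e4 where e: "e1 = r3 + r4 + r5 + r6"
    "e2 = r3 * r4 + r3 * r5 + r3 * r6 + r4 * r5 + r4 * r6 + r5 * r6"
    "e3 = r3 * r4 * r5 + r3 * r4 * r6 + r3 * r5 * r6 + r4 * r5 * r6"
    "e4 = r3 * r4 * r5 * r6"
  define z1 z2 z3 z4 z5 z6 where zz:
    "z1 = - (r3 * r4) + r3 * r5 - r3 * r6 - r4 * r5 + r4 * r6 + r5 * r6"
    "z2 = r3 * r4 + r3 * r5 - r3 * r6 - r4 * r5 + r4 * r6 - r5 * r6"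
    "z3 = - (r3 * r4) + r3 * r5 + r3 * r6 + r4 * r5 - r4 * r6 - r5 * r6"
    "z4 = - (r3 * r4) - r3 * r5 + r3 * r6 + r4 * r5 + r4 * r6 - r5 * r6"
    "z5 = r3 * r4 - r3 * r5 - r3 * r6 + r4 * r5 - r4 * r6 + r5 * r6"
    "z6 = r3 * r4 - r3 * r5 + r3 * r6 - r4 * r5 - r4 * r6 + r5 * r6"
  define z where "z = (\<lambda>i::nat. if i = 1 then z1 else if i = 2 then z2 else if i = 3 then z3
    else if i = 4 then z4 else if i = 5 then z5 else z6)"
  define a where "a = (\<lambda>k::nat. if k = 1 then 1 else if k = 2 then - e1 else if k = 3 then e2
    else if k = 4 then - e3 else if k = 5 then e4 else 0)"
  have a: "a 0 = 0" "a (Suc 0) = 1" "a 2 = - e1" "a 3 = e2" "a 4 = - e3" "a 5 = e4" "a 6 = 0"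
    by (simp_all add: a_def)
  define s1 s2 s3 p1 p2 p3 where s: "s1 = z1 + z2" "s2 = z3 + z4" "s3 = z5 + z6"
    "p1 = z1 * z2" "p2 = z3 * z4" "p3 = z5 * z6"
  have E: "esym z (Suc 0) = s1 + s2 + s3"
    "esym z 2 = p1 + p2 + p3 + s1 * s2 + s1 * s3 + s2 * s3"
    "esym z 3 = p1 * (s2 + s3) + p2 * (s1 + s3) + p3 * (s1 + s2) + s1 * s2 * s3"
    "esym z 4 = p1 * p2 + p1 * p3 + p2 * p3 + p1 * s2 * s3 + p2 * s1 * s3 + p3 * s1 * s2"
    "esym z 5 = p1 * p2 * s3 + p1 * p3 * s2 + p2 * p3 * s1"
    "esym z 6 = p1 * p2 * p3"
    by (rule esym_pairs; simp add: z_def s)+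
  note S = sextuple_symmetric_functions[OF zz s, folded e]
  (* Modulo the Pluecker relations, the bracket sums are even. *)
  have "joubert_relations a (\<lambda>i. 2 * z i)"
  proof -
    have "esym (\<lambda>i. 2 * z i) 5 = 1024 * (r3 * r4 * r5 * r6 *
        ((r3 - r4) * (r3 - r5) * (r3 - r6) * (r4 - r5) * (r4 - r6) * (r5 - r6)))"
      using sextuple_esym5[OF zz] by (simp add: esym_scale E s)
    moreover have "esym z (Suc 0) = 0" "esym z 3 = 0"
      unfolding E s zz by algebra+
    moreover have E2: "esym (\<lambda>i. 2 * z i) 2 = 4 * (p1 + p2 + p3 + s1 * s2 + s1 * s3 + s2 * s3)"
      "esym (\<lambda>i. 2 * z i) 4 = 16 * (p1 * p2 + p1 * p3 + p2 * p3 + p1 * s2 * s3 + p2 * s1 * s3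
          + p3 * s1 * s2)"
      "esym (\<lambda>i. 2 * z i) 6 = 64 * (p1 * p2 * p3)"
      "esym (\<lambda>i. 2 * z i) 5 ^ 2 = 1024 * (p1 * p2 * s3 + p1 * p3 * s2 + p2 * p3 * s1) ^ 2"
      by (simp_all add: esym_scale E power_mult_distrib del: distrib_left_numeral)
    moreover have "u6 a = rel6 (\<lambda>i. 2 * z i) / 30720 \<and>
        u10 a = - 7 / 2230272000 * rel10 (\<lambda>i. 2 * z i)
        + (6287879 / 243302400000 * esym (\<lambda>i. 2 * z i) 4
            - 17957197 / 4460544000000 * esym (\<lambda>i. 2 * z i) 2 ^ 2)
          * rel6 (\<lambda>i. 2 * z i)"
      unfolding rel6_def rel10_def
    proof (intro conjI; rule u_normal[OF a, where ?c5.0 = "esym (\<lambda>i. 2 * z i) 5"])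
    qed (simp_all add: E2 S)
    ultimately show ?thesis
      using r by (simp add: joubert_relations_def esym_scale)
  qed
  from joubert_relations_scale[OF c0 this] show ?thesis
  proof (rule joubert_relations_cong)
    show "k \<le> 6 \<Longrightarrow> lin_coeff \<alpha> \<beta> 6 k = c * a k" for k
      unfolding le_numeral_cases
      by (elim disjE; erule ssubst; simp add: ab b a c_def e; algebra?)
    have "i = Suc 0 \<or> i = 2 \<or> i = 3 \<or> i = 4 \<or> i = 5 \<or> i = 6 \<Longrightarrow> joubert \<alpha> \<beta> i = c * (2 * z i)" for i
      by (elim disjE; erule ssubst; simp add: joubert_def bracket_def ab b c_def z_def zz; algebra)
    then show "joubert \<alpha> \<beta> i = c * (2 * z i)" if "1 \<le> i" "i \<le> 6" for i
      using that by (auto simp: numeral_eq_Suc le_Suc_eq)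
  qed
qed

lemma u_lin_coeff_shift:
  "u6 (lin_coeff \<alpha> (\<lambda>i. \<beta> i - h * \<alpha> i) 6) = u6 (lin_coeff \<alpha> \<beta> 6)"
  "u10 (lin_coeff \<alpha> (\<lambda>i. \<beta> i - h * \<alpha> i) 6) = u10 (lin_coeff \<alpha> \<beta> 6)"
  by (rule trans[OF u_cong(1)[OF lin_coeff_shift] u_shift(1)]
      trans[OF u_cong(2)[OF lin_coeff_shift] u_shift(2)]; assumption)+

lemma u_lin_coeff_rot:
  "u6 (lin_coeff \<beta> (\<lambda>i. - \<alpha> i) 6) = u6 (lin_coeff \<alpha> \<beta> 6)"
  "u10 (lin_coeff \<beta> (\<lambda>i. - \<alpha> i) 6) = u10 (lin_coeff \<alpha> \<beta> 6)"
  by (rule trans[OF u_cong(1)[OF lin_coeff_rot] u_rot(1)]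
      trans[OF u_cong(2)[OF lin_coeff_rot] u_rot(2)]; assumption)+

text \<open>Translations and the rotation bring the first point to infinity and the second to 0.
  They preserve all brackets, hence the Joubert coordinates, and they preserve \<open>u6\<close> and
  \<open>u10\<close>.\<close>

lemma joubert_relations:
  assumes "\<And>i j. i \<in> {1..6} \<Longrightarrow> j \<in> {1..6} \<Longrightarrow> i \<noteq> j \<Longrightarrow> bracket \<alpha> \<beta> i j \<noteq> 0"
  shows "joubert_relations (lin_coeff \<alpha> \<beta> 6) (joubert \<alpha> \<beta>)"
proof -
  have *: "joubert_relations (lin_coeff \<alpha> \<beta> 6) (joubert \<alpha> \<beta>)"
    if nz: "\<And>i j. i \<in> {1..6} \<Longrightarrow> j \<in> {1..6} \<Longrightarrow> i \<noteq> j \<Longrightarrow> bracket \<alpha> \<beta> i j \<noteq> 0"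
      and "\<alpha> 1 = 0" for \<alpha> \<beta>
  proof -
    \<comment> \<open>Translate the second point to 0; it is finite, being distinct from the first,
      which is infinity.\<close>
    define \<beta>' where "\<beta>' = (\<lambda>i. \<beta> i - \<beta> 2 / \<alpha> 2 * \<alpha> i)"
    have br: "bracket \<alpha> \<beta>' = bracket \<alpha> \<beta>"
      unfolding \<beta>'_def by (rule bracket_shift)
    have "\<alpha> 2 \<noteq> 0" using nz[of 1 2] \<open>\<alpha> 1 = 0\<close> by (auto simp: bracket_def)
    then have "joubert_relations (lin_coeff \<alpha> \<beta>' 6) (joubert \<alpha> \<beta>')"
    proof (intro joubert_relations_pencil)
      show "\<beta>' 2 = 0" using \<open>\<alpha> 2 \<noteq> 0\<close> by (simp add: \<beta>'_def)
    qed (use nz \<open>\<alpha> 1 = 0\<close> in \<open>simp_all add: br\<close>)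
    then show ?thesis
      unfolding joubert_relations_def joubert_cong[OF br] unfolding \<beta>'_def u_lin_coeff_shift .
  qed
  show ?thesis
  proof (cases "\<alpha> 1 = 0")
    case True
    with assms show ?thesis by (rule *)
  next
    case False
    \<comment> \<open>Translate the first point to 0; the rotation then takes it to
      infinity.\<close>
    define \<beta>' where "\<beta>' = (\<lambda>i. \<beta> i - \<beta> 1 / \<alpha> 1 * \<alpha> i)"
    have br: "bracket \<beta>' (\<lambda>i. - \<alpha> i) = bracket \<alpha> \<beta>"
      unfolding bracket_rot \<beta>'_def by (rule bracket_shift)
    have "joubert_relations (lin_coeff \<beta>' (\<lambda>i. - \<alpha> i) 6) (joubert \<beta>' (\<lambda>i. - \<alpha> i))"
    proof (intro *)
      show "\<beta>' 1 = 0" using False by (simp add: \<beta>'_def)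
    qed (use assms in \<open>simp add: br\<close>)
    then show ?thesis
      unfolding joubert_relations_def joubert_cong[OF br] u_lin_coeff_rot
          unfolding \<beta>'_def u_lin_coeff_shift .
  qed
qed

section \<open>Ricochet configurations in Joubert coordinates\<close>

lemma prod_eq_esym:
  assumes "esym x 1 = 0" "esym x 3 = 0"
  shows "(T - x 1) * (T - x 2) * (T - x 3) * (T - x 4) * (T - x 5) * (T - x 6) =
    T ^ 6 + esym x 2 * T ^ 4 + esym x 4 * T ^ 2 - esym x 5 * T + esym x 6"
proof -
  have "(T - x 1) * (T - x 2) * (T - x 3) * (T - x 4) * (T - x 5) * (T - x 6) =
    T ^ 6 - esym x (Suc 0) * T ^ 5 + esym x 2 * T ^ 4 - esym x 3 * T ^ 3 + esym x 4 * T ^ 2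
      - esym x 5 * T + esym x 6"
    unfolding esym_pairs[OF refl refl refl refl refl refl] by algebra
  with assms show ?thesis by simp
qed

lemma form_inject: "form n a = form n b \<Longrightarrow> k \<le> n \<Longrightarrow> a k = b k"
  by (drule arg_cong[where f = "\<lambda>P. coeff P k"]) (simp add: coeff_form)

lemma esym_permute:
  assumes "q permutes {1..6}" "k \<le> 6"
  shows "esym (x \<circ> q) k = esym x k"
proof -
  have "form 6 (lin_coeff (\<lambda>_. 1) (x \<circ> q) 6) = form 6 (lin_coeff (\<lambda>_. 1) x 6)"
    unfolding prod_linear_form[symmetric]
    using prod.permute[OF assms(1), of "\<lambda>i. scal 1 x1 - scal (x i) x2"] by (simp add: o_def)
  from form_inject[OF this \<open>k \<le> 6\<close>] show ?thesis by (simp only: esym_def)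
qed

text \<open>With \<open>u = - x 6\<close> this is the pattern -3u, -u and two pairs of sum 2u. The
  positions are those that arise when the points 1 to 6 play the roles A to F.\<close>

definition ricochet :: "(nat \<Rightarrow> complex) \<Rightarrow> bool" where
  "ricochet x \<longleftrightarrow> x 1 = 3 * x 6 \<and> x 2 + x 3 = - 2 * x 6 \<and> x 4 + x 5 = - 2 * x 6"

lemma ricochet_scale: "c \<noteq> 0 \<Longrightarrow> ricochet (\<lambda>i. c * x i) \<longleftrightarrow> ricochet x"
proof -
  assume c: "c \<noteq> 0"
  have "c * x 1 = 3 * (c * x 6) \<longleftrightarrow> c * (x 1 - 3 * x 6) = 0" by algebra
  moreover have "c * x 2 + c * x 3 = - 2 * (c * x 6) \<longleftrightarrow> c * (x 2 + x 3 + 2 * x 6) = 0" by algebra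
  moreover have "c * x 4 + c * x 5 = - 2 * (c * x 6) \<longleftrightarrow> c * (x 4 + x 5 + 2 * x 6) = 0" by algebra
  ultimately show ?thesis using c by (simp add: ricochet_def eq_neg_iff_add_eq_0)
qed

lemma ricochet_imp_relations:
  assumes "ricochet x" "esym x 3 = 0" "esym x 5 \<noteq> 0"
  shows "rel6 x = 0" "rel10 x = 0"
proof -
  define u where "u = - x 6"
  define p where "p = x 2 * x 3"
  define q where "q = x 4 * x 5"
  have x: "x 6 = - u" "x 1 = - 3 * u" "x 3 = 2 * u - x 2" "x 5 = 2 * u - x 4"
    using assms(1) by (auto simp: ricochet_def u_def algebra_simps)
  note e = esym_pairs[OF refl refl refl refl refl refl, of x, unfolded x]
  have "esym x 3 = - 2 * u * (p + q + 2 * u ^ 2)"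
    unfolding e p_def q_def x by algebra
  moreover have "esym x 5 = u * (6 * u ^ 2 * p + 6 * u ^ 2 * q - 4 * p * q)"
    unfolding e p_def q_def x by algebra
  ultimately have "p + q + 2 * u ^ 2 = 0"
    using assms(2,3) by auto
  then have q: "q = - 2 * u ^ 2 - p" by algebra
  have e2: "esym x 2 = - 11 * u ^ 2"
    using q unfolding e p_def q_def x by algebra
  have e4: "esym x 4 = 22 * u ^ 4 + p * q"
    using q unfolding e p_def q_def x by algebra
  have e5: "esym x 5 = - 12 * u ^ 5 - 4 * u * p * q"
    using q unfolding e p_def q_def x by algebra
  have e6: "esym x 6 = 3 * u ^ 2 * p * q"
    unfolding e p_def q_def x by algebra
  show "rel6 x = 0" "rel10 x = 0"
    unfolding rel6_def rel10_def e2 e4 e5 e6 by algebra+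
qed

lemma relations_imp_ricochet:
  assumes e1: "esym x 1 = 0" and e3: "esym x 3 = 0" and e5: "esym x 5 \<noteq> 0"
    and r: "rel6 x = 0" "rel10 x = 0"
  shows "\<exists>q. q permutes {1..6} \<and> ricochet (x \<circ> q)"
proof -
  obtain v where v: "esym x 2 = - 11 * v ^ 2"
    using power2_csqrt[of "esym x 2 / - 11"]
        by (metis divide_eq_eq mult.commute neg_equal_0_iff_equal zero_neq_numeral)
  \<comment> \<open>Since 161051 = 11^5, substituting \<open>v\<close> turns \<open>rel10\<close>
    into a difference of squares. The sign of the square root is then absorbed into
    \<open>v\<close>.\<close>
  have "161051 * (esym x 5 ^ 2 - (v * (76 * v ^ 4 - 4 * esym x 4)) ^ 2) = 0"
    using r(2) unfolding rel10_def v by algebra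
  then have "(esym x 5 - v * (76 * v ^ 4 - 4 * esym x 4)) *
      (esym x 5 + v * (76 * v ^ 4 - 4 * esym x 4)) = 0"
    by algebra
  then have "\<exists>u. esym x 2 = - 11 * u ^ 2 \<and> esym x 5 = u * (76 * u ^ 4 - 4 * esym x 4)"
    unfolding mult_eq_0_iff
  proof
    assume "esym x 5 - v * (76 * v ^ 4 - 4 * esym x 4) = 0"
    with v show ?thesis by (intro exI[of _ v]) simp
  next
    assume "esym x 5 + v * (76 * v ^ 4 - 4 * esym x 4) = 0"
    with v show ?thesis by (intro exI[of _ "- v"]) (simp add: eq_neg_iff_add_eq_0)
  qed
  then obtain u where u2: "esym x 2 = - 11 * u ^ 2"
      and u5: "esym x 5 = u * (76 * u ^ 4 - 4 * esym x 4)"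
    by blast
  have u6': "esym x 6 = - 66 * u ^ 6 + 3 * u ^ 2 * esym x 4"
  proof -
    have "121 * (esym x 6 - (- 66 * u ^ 6 + 3 * u ^ 2 * esym x 4)) = 0"
      using r(1) unfolding rel6_def u2 by algebra
    then show ?thesis by algebra
  qed
  have "u \<noteq> 0" using e5 u5 by auto
  have root: "\<exists>i\<in>{1..6}. x i = T"
    if "T ^ 6 + esym x 2 * T ^ 4 + esym x 4 * T ^ 2 - esym x 5 * T + esym x 6 = 0" for T
    using that prod_eq_esym[OF e1 e3, of T] by (force simp del: One_nat_def)
  \<comment> \<open>Once \<open>esym x 2\<close>, \<open>esym x 5\<close>, \<open>esym x 6\<close>
    are expressed by \<open>u\<close> and \<open>esym x 4\<close>, the polynomial with roots
    \<open>x 1\<close>, ..., \<open>x 6\<close> vanishes identically at -3u and at -u.\<close>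
  obtain i where i: "i \<in> {1..6}" "x i = - 3 * u"
  proof -
    have "\<exists>i\<in>{1..6}. x i = - 3 * u"
      by (rule root) (unfold u2 u5 u6', algebra)
    with that show ?thesis by blast
  qed
  obtain j where j: "j \<in> {1..6}" "x j = - u"
  proof -
    have "\<exists>i\<in>{1..6}. x i = - u"
      by (rule root) (unfold u2 u5 u6', algebra)
    with that show ?thesis by blast
  qed
  have "i \<noteq> j" using i j \<open>u \<noteq> 0\<close> by auto
  \<comment> \<open>The inner transposition takes 6 to the preimage of \<open>j\<close> under the
    outer one, so the overlaps \<open>i = 6\<close> and \<open>j = 1\<close> are covered.\<close>
  define q where
      "q = Transposition.transpose 1 i \<circ> Transposition.transpose 6 (Transposition.transpose 1 i j)"
  have q: "q permutes {1..6}"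
    unfolding q_def using i j by (intro permutes_compose permutes_swap_id)
      (auto simp: Transposition.transpose_def)
  have "q 1 = i" "q 6 = j"
    using \<open>i \<noteq> j\<close> by (auto simp: q_def Transposition.transpose_def)
  define y where "y = x \<circ> q"
  have y: "y 1 = - 3 * u" "y 6 = - u"
    using i j \<open>q 1 = i\<close> \<open>q 6 = j\<close> by (simp_all add: y_def)
  have s: "y 3 = 4 * u - y 2 - y 4 - y 5"
  proof -
    have "esym y (Suc 0) = 0" using esym_permute[OF q, of 1 x] e1 by (simp add: y_def)
    then show ?thesis
      unfolding esym_pairs(1)[OF refl refl refl refl refl refl] y by algebra
  qed
  have y3: "esym y 3 = 0" and y2: "esym y 2 = - 11 * u ^ 2"
    using esym_permute[OF q, of 3 x] esym_permute[OF q, of 2 x] e3 u2 by (simp_all add: y_def)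
  \<comment> \<open>For four numbers of sum zero the third elementary symmetric function is
    \<open>(w1 + w2) * (w1 + w3) * (w1 + w4)\<close>. Applied to the remaining four coordinates
    minus their mean \<open>u\<close>, it vanishes by \<open>y3\<close> and
    \<open>y2\<close>.\<close>
  have "(y 2 + y 3 - y 4 - y 5) * (y 2 + y 4 - y 3 - y 5) * (y 2 + y 5 - y 3 - y 4) = 0"
    using y3 y2 unfolding esym_pairs[OF refl refl refl refl refl refl] y s by algebra
  then consider "y 2 + y 3 = y 4 + y 5" | "y 2 + y 4 = y 3 + y 5" | "y 2 + y 5 = y 3 + y 4"
    unfolding mult_eq_0_iff diff_diff_eq eq_iff_diff_eq_0[symmetric] by blast
  then show ?thesis
  proof cases
    case 1
    then have "ricochet y" unfolding ricochet_def y using s by (simp, algebra)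
    with q show ?thesis by (auto simp: y_def)
  next
    case 2
    \<comment> \<open>The other two pairings reduce to the first by exchanging one position.\<close>
    then have "ricochet (y \<circ> Transposition.transpose 3 4)"
      unfolding ricochet_def using y s by (simp add: Transposition.transpose_def, algebra)
    moreover have "q \<circ> Transposition.transpose 3 4 permutes {1..6}"
      by (intro permutes_compose permutes_swap_id q) auto
    ultimately show ?thesis unfolding y_def comp_assoc by blast
  next
    case 3
    then have "ricochet (y \<circ> Transposition.transpose 3 5)"
      unfolding ricochet_def using y s by (simp add: Transposition.transpose_def, algebra)
    moreover have "q \<circ> Transposition.transpose 3 5 permutes {1..6}"
      by (intro permutes_compose permutes_swap_id q) auto
    ultimately show ?thesis unfolding y_def comp_assoc by blast
  qed
qed

section \<open>Permutations of the coordinates induced by permutations of the points\<close>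

text \<open>Membership in the image of the outer automorphism of the symmetric group. The factor
  \<open>c\<close> is common to all coordinates and independent of the points, so it is harmless for
  \<open>ricochet\<close> and multiplies under composition.\<close>

definition joubert_realizable :: "(nat \<Rightarrow> nat) \<Rightarrow> bool" where
  "joubert_realizable q \<longleftrightarrow> (\<exists>p c. p permutes {1..6} \<and> c \<noteq> 0 \<and>
     (\<forall>\<alpha> \<beta>. \<forall>i\<in>{1..6}. joubert (\<alpha> \<circ> p) (\<beta> \<circ> p) i = c * joubert \<alpha> \<beta> (q i)))"

lemma joubert_realizable_compose:
  assumes "joubert_realizable q" "joubert_realizable r" "r permutes {1..6}"
  shows "joubert_realizable (q \<circ> r)"
proof -
  obtain p c where p: "p permutes {1..6}" "c \<noteq> 0"
    "\<And>\<alpha> \<beta> i. i \<in> {1..6} \<Longrightarrow> joubert (\<alpha> \<circ> p) (\<beta> \<circ> p) i = c * joubert \<alpha> \<beta> (q i)"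
    using assms(1) unfolding joubert_realizable_def by blast
  obtain p' c' where p': "p' permutes {1..6}" "c' \<noteq> 0"
    "\<And>\<alpha> \<beta> i. i \<in> {1..6} \<Longrightarrow> joubert (\<alpha> \<circ> p') (\<beta> \<circ> p') i = c' * joubert \<alpha> \<beta> (r i)"
    using assms(2) unfolding joubert_realizable_def by blast
  have "joubert (\<alpha> \<circ> (p \<circ> p')) (\<beta> \<circ> (p \<circ> p')) i = c' * c * joubert \<alpha> \<beta> ((q \<circ> r) i)" if "i
      \<in> {1..6}" for \<alpha> \<beta> i
  proof -
    have "r i \<in> {1..6}" using assms(3) that by (simp only: permutes_in_image)
    then show ?thesis
      using p'(3)[OF that, of "\<alpha> \<circ> p" "\<beta> \<circ> p"] p(3)[of "r i" \<alpha> \<beta>] by (simp add: comp_assoc)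
  qed
  moreover have "p \<circ> p' permutes {1..6}" using p' p by (intro permutes_compose)
  ultimately show ?thesis
    unfolding joubert_realizable_def using p(2) p'(2) by (intro exI[of _ "p \<circ> p'"] exI[of _
        "c' * c"]) simp
qed

lemma joubert_eqs:
  fixes \<alpha> \<beta>
  defines "d \<equiv> bracket \<alpha> \<beta>"
  shows"joubert \<alpha> \<beta> (Suc 0) = d 1 2 * d 3 4 * d 5 6 + d 1 3 * d 2 5 * d 4 6
      + d 1 4 * d 2 6 * d 3 5 + d 1 5 * d 2 4 * d 3 6 + d 1 6 * d 2 3 * d 4 5"
    and "joubert \<alpha> \<beta> 2 = d 1 2 * d 3 4 * d 5 6 - d 1 3 * d 2 6 * d 4 5 - d 1 4 * d 2 5 * d 3 6
        - d 1 5 * d 2 3 * d 4 6 - d 1 6 * d 2 4 * d 3 5"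
    and "joubert \<alpha> \<beta> 3 = - d 1 2 * d 3 5 * d 4 6 - d 1 3 * d 2 4 * d 5 6 - d 1 4 * d 2 5 * d 3 6
        - d 1 5 * d 2 6 * d 3 4 + d 1 6 * d 2 3 * d 4 5"
    and "joubert \<alpha> \<beta> 4 = - d 1 2 * d 3 5 * d 4 6 - d 1 3 * d 2 6 * d 4 5 + d 1 4 * d 2 3 * d 5 6
        + d 1 5 * d 2 4 * d 3 6 + d 1 6 * d 2 5 * d 3 4"
    and "joubert \<alpha> \<beta> 5 = d 1 2 * d 3 6 * d 4 5 - d 1 3 * d 2 4 * d 5 6 + d 1 4 * d 2 6 * d 3 5
        - d 1 5 * d 2 3 * d 4 6 + d 1 6 * d 2 5 * d 3 4"
    and "joubert \<alpha> \<beta> 6 = d 1 2 * d 3 6 * d 4 5 + d 1 3 * d 2 5 * d 4 6 + d 1 4 * d 2 3 * d 5 6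
        - d 1 5 * d 2 6 * d 3 4 - d 1 6 * d 2 4 * d 3 5"
  by (simp_all only: joubert_def d_def Let_def) simp_all

text \<open>The totals 1 and \<open>b\<close> share exactly one splitting into three pairs. Swapping
  the points within each of these pairs exchanges the two coordinates and keeps the others, up to
  the sign -1.\<close>

lemma joubert_realizable_transpose_1:
  assumes "b \<in> {2..6}"
  shows "joubert_realizable (Transposition.transpose 1 b)"
proof -
  have *: "joubert_realizable (Transposition.transpose 1 b)"
    if "p permutes {1..6}"
      "\<And>\<alpha> \<beta> i. i = Suc 0 \<or> i = 2 \<or> i = 3 \<or> i = 4 \<or> i = 5 \<or> i = 6 \<Longrightarrow>
         joubert (\<alpha> \<circ> p) (\<beta> \<circ> p) i = - joubert \<alpha> \<beta> (Transposition.transpose 1 b i)" for p b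
    unfolding joubert_realizable_def using that
    by (intro exI[of _ p] exI[of _ "-1"]) (auto simp: numeral_eq_Suc le_Suc_eq)
  let ?t = "\<lambda>a b c d e f :: nat. Transposition.transpose a b \<circ> Transposition.transpose c d \<circ> Transposition.transpose e f"
  have p: "?t a b c d e f permutes {1..6}" if "{a, b, c, d, e, f} \<subseteq> {1..6}" for a b c d e f
    using that by (intro permutes_compose permutes_swap_id) auto
  consider "b = 2" | "b = 3" | "b = 4" | "b = 5" | "b = 6"
    using assms by force
  then show ?thesis
  proof cases
    case 1
    show ?thesis unfolding 1
    proof (rule *[of "?t 1 2 3 4 5 6"])
      show "joubert (\<alpha> \<circ> ?t 1 2 3 4 5 6) (\<beta> \<circ> ?t 1 2 3 4 5 6) i =
          - joubert \<alpha> \<beta> (Transposition.transpose 1 2 i)"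
        if "i = Suc 0 \<or> i = 2 \<or> i = 3 \<or> i = 4 \<or> i = 5 \<or> i = 6" for \<alpha> \<beta> i
        using that
            by (elim disjE) (simp_all add: joubert_eqs bracket_def
            Transposition.transpose_def algebra_simps)
    qed (rule p, simp)
  next
    case 2
    show ?thesis unfolding 2
    proof (rule *[of "?t 1 6 2 3 4 5"])
      show "joubert (\<alpha> \<circ> ?t 1 6 2 3 4 5) (\<beta> \<circ> ?t 1 6 2 3 4 5) i =
          - joubert \<alpha> \<beta> (Transposition.transpose 1 3 i)"
        if "i = Suc 0 \<or> i = 2 \<or> i = 3 \<or> i = 4 \<or> i = 5 \<or> i = 6" for \<alpha> \<beta> i
        using that
            by (elim disjE) (simp_all add: joubert_eqs bracket_def
            Transposition.transpose_def algebra_simps)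
    qed (rule p, simp)
  next
    case 3
    show ?thesis unfolding 3
    proof (rule *[of "?t 1 5 2 4 3 6"])
      show "joubert (\<alpha> \<circ> ?t 1 5 2 4 3 6) (\<beta> \<circ> ?t 1 5 2 4 3 6) i =
          - joubert \<alpha> \<beta> (Transposition.transpose 1 4 i)"
        if "i = Suc 0 \<or> i = 2 \<or> i = 3 \<or> i = 4 \<or> i = 5 \<or> i = 6" for \<alpha> \<beta> i
        using that
            by (elim disjE) (simp_all add: joubert_eqs bracket_def
            Transposition.transpose_def algebra_simps)
    qed (rule p, simp)
  next
    case 4
    show ?thesis unfolding 4
    proof (rule *[of "?t 1 4 2 6 3 5"])
      show "joubert (\<alpha> \<circ> ?t 1 4 2 6 3 5) (\<beta> \<circ> ?t 1 4 2 6 3 5) i =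
          - joubert \<alpha> \<beta> (Transposition.transpose 1 5 i)"
        if "i = Suc 0 \<or> i = 2 \<or> i = 3 \<or> i = 4 \<or> i = 5 \<or> i = 6" for \<alpha> \<beta> i
        using that
            by (elim disjE) (simp_all add: joubert_eqs bracket_def
            Transposition.transpose_def algebra_simps)
    qed (rule p, simp)
  next
    case 5
    show ?thesis unfolding 5
    proof (rule *[of "?t 1 3 2 5 4 6"])
      show "joubert (\<alpha> \<circ> ?t 1 3 2 5 4 6) (\<beta> \<circ> ?t 1 3 2 5 4 6) i =
          - joubert \<alpha> \<beta> (Transposition.transpose 1 6 i)"
        if "i = Suc 0 \<or> i = 2 \<or> i = 3 \<or> i = 4 \<or> i = 5 \<or> i = 6" for \<alpha> \<beta> i
        using that
            by (elim disjE) (simp_all add: joubert_eqs bracket_def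
            Transposition.transpose_def algebra_simps)
    qed (rule p, simp)
  qed
qed

text \<open>The transpositions that move 1 generate the symmetric group.\<close>

lemma joubert_realizable_permutes:
  assumes "q permutes {1..6}"
  shows "joubert_realizable q"
proof -
  have id: "joubert_realizable id"
    unfolding joubert_realizable_def by (intro exI[of _ id] exI[of _ 1]) (auto simp: permutes_id)
  have 1: "joubert_realizable (Transposition.transpose 1 b)" if "b \<in> {1..6}" for b
    using joubert_realizable_transpose_1[of b] id that
    by (cases "b = 1") (auto simp del: One_nat_def)
  have perm: "Transposition.transpose 1 b permutes {1..6}" if "b \<in> {1..6}" for b :: nat
    using that by (intro permutes_swap_id) auto
  have tr: "joubert_realizable (Transposition.transpose a b)"
    if "a \<in> {1..6}" "b \<in> {1..6}" "a \<noteq> b" for a b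
  proof (cases "a = 1 \<or> b = 1")
    case True
    then show ?thesis using 1 that by (metis transpose_commute)
  next
    case False
    have "Transposition.transpose a b =
        Transposition.transpose 1 a \<circ> Transposition.transpose 1 b \<circ> Transposition.transpose 1 a"
      using False \<open>a \<noteq> b\<close> by (auto simp: fun_eq_iff Transposition.transpose_def)
    then show ?thesis
      using that by (auto intro!: joubert_realizable_compose 1 perm simp del: One_nat_def)
  qed
  have "finite {1..6::nat}" by simp
  with assms show ?thesis
  proof (induction rule: permutes_induct)
    case (swap a b p)
    then show ?case by (blast intro: joubert_realizable_compose tr)
  qed (rule id)
qed

section \<open>Fractional linear maps and the ricochet condition\<close>

lemma proj_quot_eq_iff:
  assumes "(a, b) \<noteq> (0, 0)" "(c, d) \<noteq> (0, 0)"
  shows "proj_quot a b = proj_quot c d \<longleftrightarrow> a * d = c * b"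
  using assms by (auto simp: proj_quot_def frac_eq_eq)

text \<open>In homogeneous coordinates the map is linear, so infinity needs no separate treatment
  later.\<close>

lemma mobius_proj_quot:
  assumes "(x, y) \<noteq> (0, 0)"
  shows "mobius a b c d (proj_quot x y) = proj_quot (a * x + b * y) (c * x + d * y)"
proof (cases "y = 0")
  case True
  with assms show ?thesis by (auto simp: mobius_def proj_quot_def)
next
  case False
  then have "a * (x / y) + b = (a * x + b * y) / y" "c * (x / y) + d = (c * x + d * y) / y"
    by (simp_all add: field_simps)
  with False show ?thesis by (simp add: mobius_def proj_quot_def)
qed

lemma joubert_linear_substitution:
  "joubert (\<lambda>i. c * \<beta> i + d * \<alpha> i) (\<lambda>i. a * \<beta> i + b * \<alpha> i) = (\<lambda>i. (a * d
      - b * c) ^ 3 * joubert \<alpha> \<beta> i)"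
proof -
  define k where "k = a * d - b * c"
  have "bracket (\<lambda>i. c * \<beta> i + d * \<alpha> i) (\<lambda>i. a * \<beta> i + b * \<alpha> i) =
      (\<lambda>i j. k * bracket \<alpha> \<beta> i j)"
    by (simp add: bracket_def k_def fun_eq_iff algebra_simps)
  then have "joubert (\<lambda>i. c * \<beta> i + d * \<alpha> i) (\<lambda>i. a * \<beta> i + b * \<alpha> i) = (\<lambda>i. k ^ 3 * joubert \<alpha> \<beta> i)"
    by (simp add: joubert_def Let_def fun_eq_iff power3_eq_cube algebra_simps)
  then show ?thesis by (simp only: k_def)
qed

text \<open>The points 1, 3, 4 are 0, infinity and 1. The right side says that point 6 is -1 and,
  with t for point 2, that point 5 is (t-1)/(t+1), in cross-multiplied form.\<close>

lemma ricochet_joubert_normalised: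
  assumes nz: "\<And>i j. i \<in> {1..6} \<Longrightarrow> j \<in> {1..6} \<Longrightarrow> i \<noteq> j \<Longrightarrow> bracket \<alpha> \<beta> i j \<noteq> 0"
    and n: "\<beta> 1 = 0" "\<alpha> 3 = 0" "\<beta> 4 = \<alpha> 4"
  shows "ricochet (joubert \<alpha> \<beta>) \<longleftrightarrow>
    \<beta> 6 = - \<alpha> 6 \<and> \<beta> 5 * (\<beta> 2 + \<alpha> 2) = \<alpha> 5 * (\<beta> 2 - \<alpha> 2)"
proof -
  define x where "x = joubert \<alpha> \<beta>"
  define k where "k = \<alpha> 1 * \<beta> 3 * \<alpha> 4"
  note X = joubert_eqs[of \<alpha> \<beta>, folded x_def One_nat_def, unfolded bracket_def n]
  \<comment> \<open>The vanishing sum reduces \<open>ricochet\<close> to two equations: equal pair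
    sums and \<open>x 1 = 3 * x 6\<close>.\<close>
  have sum: "x 1 + (x 2 + x 3) + (x 4 + x 5) + x 6 = 0"
    unfolding X by algebra
  \<comment> \<open>By this factorisation equal pair sums mean exactly that point 6 is -1, harmonic
    to 1 with respect to 0 and infinity.\<close>
  have d: "(x 2 + x 3) - (x 4 + x 5) = 4 * k * bracket \<alpha> \<beta> 2 5 * (\<alpha> 6 + \<beta> 6)"
    unfolding X k_def bracket_def by algebra
  \<comment> \<open>Modulo the equation for point 6, the second equation is the condition on point
    5.\<close>
  have d1: "x 1 - 3 * x 6 = k * (8 * \<alpha> 6 * (\<beta> 5 * (\<beta> 2 + \<alpha> 2) - \<alpha> 5 * (\<beta> 2 - \<alpha> 2))
      + (4 * \<beta> 2 * \<alpha> 5 - 8 * \<alpha> 2 * \<alpha> 5 - 4 * \<alpha> 2 * \<beta> 5) * (\<alpha> 6 + \<beta> 6))"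
    unfolding X k_def by algebra
  have "k \<noteq> 0" "\<alpha> 6 \<noteq> 0" "bracket \<alpha> \<beta> 2 5 \<noteq> 0"
    using nz[of 1 4] nz[of 3 4] nz[of 3 6] nz[of 1 3] nz[of 2 5]
    by (auto simp: k_def bracket_def n simp del: One_nat_def)
  have "ricochet x \<longleftrightarrow> x 1 - 3 * x 6 = 0 \<and> (x 2 + x 3) - (x 4 + x 5) = 0"
    unfolding ricochet_def
  proof safe
    assume a: "x 1 - 3 * x 6 = 0" "(x 2 + x 3) - (x 4 + x 5) = 0"
    then show "x 1 = 3 * x 6" by algebra
    from a sum have "2 * (x 2 + x 3 + 2 * x 6) = 0" "2 * (x 4 + x 5 + 2 * x 6) = 0" by algebra+
    then show "x 2 + x 3 = - 2 * x 6" "x 4 + x 5 = - 2 * x 6" by algebra+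
  qed algebra+
  also have "\<dots> \<longleftrightarrow> x 1 - 3 * x 6 = 0 \<and> \<alpha> 6 + \<beta> 6 = 0"
    unfolding d using \<open>k \<noteq> 0\<close> \<open>bracket \<alpha> \<beta> 2 5 \<noteq> 0\<close> by simp
  also have "\<dots> \<longleftrightarrow> \<beta> 5 * (\<beta> 2 + \<alpha> 2) - \<alpha> 5 * (\<beta> 2 - \<alpha> 2) = 0 \<and> \<alpha> 6 + \<beta> 6 = 0"
    unfolding d1 using \<open>k \<noteq> 0\<close> \<open>\<alpha> 6 \<noteq> 0\<close> by auto
  also have "\<dots> \<longleftrightarrow> \<beta> 6 = - \<alpha> 6 \<and> \<beta> 5 * (\<beta> 2 + \<alpha> 2) = \<alpha> 5 * (\<beta> 2 - \<alpha> 2)"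
    by (auto simp: eq_neg_iff_add_eq_0 add.commute)
  finally show ?thesis by (simp add: x_def)
qed

text \<open>Three distinct points can be moved to 0, infinity and 1, and a linear substitution
  multiplies all Joubert coordinates by one nonzero factor.\<close>

lemma ricochet_joubert_iff:
  assumes nz: "\<And>i j. i \<in> {1..6} \<Longrightarrow> j \<in> {1..6} \<Longrightarrow> i \<noteq> j \<Longrightarrow> bracket \<alpha> \<beta> i j \<noteq> 0"
  defines "P \<equiv> \<lambda>i. proj_quot (\<beta> i) (\<alpha> i)"
  shows "ricochet (joubert \<alpha> \<beta>) \<longleftrightarrow> (\<exists>t f. fractional_linear f \<and>
    f (P 1) = Some 0 \<and> f (P 2) = Some t \<and> f (P 3) = None \<and> f (P 4) = Some 1 \<and>
    f (P 5) = proj_quot (t - 1) (t + 1) \<and> f (P 6) = Some (-1))"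
proof -
  have pt: "(\<beta> i, \<alpha> i) \<noteq> (0, 0)" if "i \<in> {1..6}" for i
    using nz[of i 1] nz[of i 2] that
    by (cases "i = 1") (auto simp: bracket_def simp del: One_nat_def)
  have main: "ricochet (joubert \<alpha> \<beta>) \<longleftrightarrow>
       \<beta>' 6 = - \<alpha>' 6 \<and> \<beta>' 5 * (\<beta>' 2 + \<alpha>' 2) = \<alpha>' 5 * (\<beta>' 2 - \<alpha>' 2)"
    if det: "a * d - b * c \<noteq> 0"
      and defs: "\<alpha>' = (\<lambda>i. c * \<beta> i + d * \<alpha> i)" "\<beta>' = (\<lambda>i. a * \<beta> i + b * \<alpha> i)"
      and n: "\<beta>' 1 = 0" "\<alpha>' 3 = 0" "\<beta>' 4 = \<alpha>' 4" for a b c d \<alpha>' \<beta>'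
  proof -
    have br: "bracket \<alpha>' \<beta>' i j = (a * d - b * c) * bracket \<alpha> \<beta> i j" for i j
      by (simp add: bracket_def defs algebra_simps)
    have "ricochet (joubert \<alpha> \<beta>) \<longleftrightarrow> ricochet (joubert \<alpha>' \<beta>')"
      unfolding defs joubert_linear_substitution using det by (simp add: ricochet_scale)
    with ricochet_joubert_normalised[of \<alpha>' \<beta>', OF _ n] nz det
    show "ricochet (joubert \<alpha> \<beta>) \<longleftrightarrow>
       \<beta>' 6 = - \<alpha>' 6 \<and> \<beta>' 5 * (\<beta>' 2 + \<alpha>' 2) = \<alpha>' 5 * (\<beta>' 2 - \<alpha>' 2)"
      by (simp add: br)
  qed
  have image_iff:
    "mobius a b c d (P i) = proj_quot x y \<longleftrightarrow> \<beta>' i * y = x * \<alpha>' i"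
    if "a * d - b * c \<noteq> 0" "\<alpha>' = (\<lambda>i. c * \<beta> i + d * \<alpha> i)" "\<beta>' = (\<lambda>i. a * \<beta> i + b * \<alpha> i)"
      "i \<in> {1..6}" "(x, y) \<noteq> (0, 0)" for a b c d \<alpha>' \<beta>' i x y
  proof -
    have "bracket \<alpha>' \<beta>' i (if i = 1 then 2 else 1) = (a * d - b * c) *
        bracket \<alpha> \<beta> i (if i = 1 then 2 else 1)"
      by (simp add: bracket_def that algebra_simps)
    then have "(\<beta>' i, \<alpha>' i) \<noteq> (0, 0)"
      using that(1,4) nz[of i "if i = 1 then 2 else 1"] by (auto simp: bracket_def)
    then show ?thesis
      unfolding P_def mobius_proj_quot[OF pt[OF \<open>i \<in> {1..6}\<close>]] that(2,3)[symmetric]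
      using that(2,3,5) by (simp add: proj_quot_eq_iff)
  qed
  have const: "Some z = proj_quot z 1" "None = proj_quot 1 0" for z
    by (simp_all add: proj_quot_def)
  show ?thesis
  proof
    assume R: "ricochet (joubert \<alpha> \<beta>)"
    \<comment> \<open>The map is the quotient of the brackets with points 1 and 3, weighted by
      \<open>k\<close> and \<open>l\<close> so that point 4 goes to 1.\<close>
    define k l where "k = bracket \<alpha> \<beta> 3 4" and "l = bracket \<alpha> \<beta> 1 4"
    define a b c d where abcd: "a = k * \<alpha> 1" "b = - k * \<beta> 1" "c = l * \<alpha> 3" "d = - l * \<beta> 3"
    define \<alpha>' where \<alpha>': "\<alpha>' = (\<lambda>i. c * \<beta> i + d * \<alpha> i)"
    define \<beta>' where \<beta>': "\<beta>' = (\<lambda>i. a * \<beta> i + b * \<alpha> i)"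
    have "a * d - b * c = - (k * l * bracket \<alpha> \<beta> 1 3)"
      by (simp add: abcd bracket_def algebra_simps)
    then have det: "a * d - b * c \<noteq> 0"
      using nz[of 3 4] nz[of 1 4] nz[of 1 3] by (simp add: k_def l_def)
    have n: "\<beta>' 1 = 0" "\<alpha>' 3 = 0" "\<beta>' 4 = \<alpha>' 4"
      by (simp_all add: \<alpha>' \<beta>' abcd k_def l_def bracket_def algebra_simps)
    have "\<alpha>' 2 = - (l * bracket \<alpha> \<beta> 2 3)"
      by (simp add: \<alpha>' abcd bracket_def algebra_simps)
    then have "\<alpha>' 2 \<noteq> 0"
      using nz[of 1 4] nz[of 2 3] by (simp add: l_def)
    define t where "t = \<beta>' 2 / \<alpha>' 2"
    have r: "\<beta>' 6 = - \<alpha>' 6" "\<beta>' 5 * (\<beta>' 2 + \<alpha>' 2) = \<alpha>' 5 * (\<beta>' 2 - \<alpha>' 2)"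
      using main[OF det \<alpha>' \<beta>' n] R by auto
    have t: "\<beta>' 2 = t * \<alpha>' 2" using \<open>\<alpha>' 2 \<noteq> 0\<close> by (simp add: t_def)
    have "\<alpha>' 2 * (\<beta>' 5 * (t + 1) - (t - 1) * \<alpha>' 5) = 0"
      using r(2) unfolding t by algebra
    with \<open>\<alpha>' 2 \<noteq> 0\<close> have "\<beta>' 5 * (t + 1) = (t - 1) * \<alpha>' 5" by simp
    moreover have "(t - 1, t + 1) \<noteq> (0, 0)"
      by (auto simp: eq_neg_iff_add_eq_0[symmetric])
    moreover have "fractional_linear (mobius a b c d)"
      using det unfolding fractional_linear_def by blast
    ultimately show "\<exists>t f. fractional_linear f \<and>
      f (P 1) = Some 0 \<and> f (P 2) = Some t \<and> f (P 3) = None \<and> f (P 4) = Some 1 \<and>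
      f (P 5) = proj_quot (t - 1) (t + 1) \<and> f (P 6) = Some (-1)"
      unfolding const using n r(1) t
      by (intro exI[of _ t] exI[of _ "mobius a b c d"]) (simp add: image_iff[OF det \<alpha>' \<beta>']
          del: One_nat_def)
  next
    assume "\<exists>t f. fractional_linear f \<and>
      f (P 1) = Some 0 \<and> f (P 2) = Some t \<and> f (P 3) = None \<and> f (P 4) = Some 1 \<and>
      f (P 5) = proj_quot (t - 1) (t + 1) \<and> f (P 6) = Some (-1)"
    then obtain t a b c d where det: "a * d - b * c \<noteq> 0" and
      f: "mobius a b c d (P 1) = proj_quot 0 1" "mobius a b c d (P 2) = proj_quot t 1"
        "mobius a b c d (P 3) = proj_quot 1 0" "mobius a b c d (P 4) = proj_quot 1 1"
        "mobius a b c d (P 5) = proj_quot (t - 1) (t + 1)" "mobius a b c d (P 6) = proj_quot (-1) 1"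
      unfolding fractional_linear_def const by blast
    define \<alpha>' where \<alpha>': "\<alpha>' = (\<lambda>i. c * \<beta> i + d * \<alpha> i)"
    define \<beta>' where \<beta>': "\<beta>' = (\<lambda>i. a * \<beta> i + b * \<alpha> i)"
    have "(t - 1, t + 1) \<noteq> (0, 0)"
      by (auto simp: eq_neg_iff_add_eq_0[symmetric])
    with f have n: "\<beta>' 1 = 0" "\<alpha>' 3 = 0" "\<beta>' 4 = \<alpha>' 4"
      and r: "\<beta>' 2 = t * \<alpha>' 2" "\<beta>' 5 * (t + 1) = (t - 1) * \<alpha>' 5" "\<beta>' 6 = - \<alpha>' 6"
      by (simp_all add: image_iff[OF det \<alpha>' \<beta>'] del: One_nat_def)
    have "\<beta>' 5 * (\<beta>' 2 + \<alpha>' 2) = \<alpha>' 5 * (\<beta>' 2 - \<alpha>' 2)"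
      using r(2) unfolding r(1) by algebra
    with main[OF det \<alpha>' \<beta>' n] r(3) show "ricochet (joubert \<alpha> \<beta>)" by blast
  qed
qed

section \<open>The characterisation by invariants\<close>

text \<open>\<open>U6\<close> is a nonzero multiple of \<open>rel6\<close>, and modulo
  \<open>rel6\<close> so is \<open>U10\<close> of \<open>rel10\<close>.\<close>

lemma U_eq_0_iff:
  assumes "\<And>i j. i \<in> {1..6} \<Longrightarrow> j \<in> {1..6} \<Longrightarrow> i \<noteq> j \<Longrightarrow> bracket \<alpha> \<beta> i j \<noteq> 0"
    and "\<Phi> = (\<Prod>i=1..6. scal (\<alpha> i) x1 - scal (\<beta> i) x2)"
  shows "U6 \<Phi> = 0 \<and> U10 \<Phi> = 0 \<longleftrightarrow> rel6 (joubert \<alpha> \<beta>) = 0 \<and> rel10 (joubert \<alpha> \<beta>) = 0"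
  using joubert_relations[of \<alpha> \<beta>, OF assms(1)]
  unfolding assms(2) prod_linear_form U_form form_0_eq_0_iff joubert_relations_def
  by auto

theorem theorem5p2:
  fixes \<Phi> :: bipoly and \<Gamma> :: "proj_line set"
  assumes "binary_form 6 \<Phi>"
    and "represents \<Phi> \<Gamma>"
    and "card \<Gamma> = 6"
  shows "R_configuration \<Gamma> \<longleftrightarrow> U6 \<Phi> = 0 \<and> U10 \<Phi> = 0"
proof -
  obtain \<alpha> \<beta> :: "nat \<Rightarrow> complex" where \<Phi>: "\<Phi> = (\<Prod>i=1..6. scal (\<alpha> i) x1 - scal (\<beta> i) x2)" "\<Phi> \<noteq> 0"
    and \<Gamma>: "\<Gamma> = (\<lambda>i. proj_quot (\<beta> i) (\<alpha> i)) ` {1..6}"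
    using assms(2) unfolding represents_def by blast
  define P where "P = (\<lambda>i. proj_quot (\<beta> i) (\<alpha> i))"
  have P: "bij_betw P {1..6} \<Gamma>"
    unfolding bij_betw_def P_def using \<Gamma> assms(3) by (auto intro: eq_card_imp_inj_on)
  have nz: "bracket \<alpha> \<beta> i j \<noteq> 0" if "i \<in> {1..6}" "j \<in> {1..6}" "i \<noteq> j" for i j
  proof -
    \<comment> \<open>A zero pair would make a linear factor, and with it \<Phi>, vanish.\<close>
    have "(\<beta> i, \<alpha> i) \<noteq> (0, 0)" if "i \<in> {1..6}" for i
      using \<Phi> that by (force simp: scal_def)
    moreover have "P i \<noteq> P j"
      using P that by (auto simp: bij_betw_def inj_on_def)
    ultimately show ?thesis
      using that by (auto simp: P_def bracket_def proj_quot_eq_iff mult.commute)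
  qed
  \<comment> \<open>Relabelling the points only reorders the factors of \<Phi>, so every labelling
    may be used.\<close>
  have perm: "U6 \<Phi> = 0 \<and> U10 \<Phi> = 0 \<longleftrightarrow> rel6 (joubert (\<alpha> \<circ> p) (\<beta> \<circ> p)) = 0
      \<and> rel10 (joubert (\<alpha> \<circ> p) (\<beta> \<circ> p)) = 0"
      "ricochet (joubert (\<alpha> \<circ> p) (\<beta> \<circ> p)) \<longleftrightarrow> (\<exists>t f. fractional_linear f \<and>
        f (P (p 1)) = Some 0 \<and> f (P (p 2)) = Some t \<and> f (P (p 3)) = None \<and> f (P (p 4)) = Some 1 \<and>
        f (P (p 5)) = proj_quot (t - 1) (t + 1) \<and> f (P (p 6)) = Some (-1))"
      "joubert_relations (lin_coeff (\<alpha> \<circ> p) (\<beta> \<circ> p) 6) (joubert (\<alpha> \<circ> p) (\<beta> \<circ> p))"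
    if p: "p permutes {1..6}" for p
  proof -
    have nz': "bracket (\<alpha> \<circ> p) (\<beta> \<circ> p) i j \<noteq> 0" if "i \<in> {1..6}" "j \<in> {1..6}" "i \<noteq> j" for i j
      using nz[of "p i" "p j"] that permutes_in_image[OF p] permutes_inj[OF p]
      by (simp add: bracket_def inj_eq)
    show "U6 \<Phi> = 0 \<and> U10 \<Phi> = 0 \<longleftrightarrow> rel6 (joubert (\<alpha> \<circ> p) (\<beta> \<circ> p)) = 0
        \<and> rel10 (joubert (\<alpha> \<circ> p) (\<beta> \<circ> p)) = 0"
      using prod.permute[OF p, of "\<lambda>i. scal (\<alpha> i) x1 - scal (\<beta> i) x2"]
      by (intro U_eq_0_iff nz') (simp_all add: \<Phi> o_def)
    show "ricochet (joubert (\<alpha> \<circ> p) (\<beta> \<circ> p)) \<longleftrightarrow> (\<exists>t f. fractional_linear f \<and>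
        f (P (p 1)) = Some 0 \<and> f (P (p 2)) = Some t \<and> f (P (p 3)) = None \<and> f (P (p 4)) = Some 1 \<and>
        f (P (p 5)) = proj_quot (t - 1) (t + 1) \<and> f (P (p 6)) = Some (-1))"
      using ricochet_joubert_iff[of "\<alpha> \<circ> p" "\<beta> \<circ> p"] nz'
      unfolding P_def o_def by blast
    show "joubert_relations (lin_coeff (\<alpha> \<circ> p) (\<beta> \<circ> p) 6) (joubert (\<alpha> \<circ> p) (\<beta> \<circ> p))"
      by (intro joubert_relations nz')
  qed
  show ?thesis
  proof
    assume "R_configuration \<Gamma>"
    then obtain A B C D E F t f where G: "\<Gamma> = {A, B, C, D, E, F}" and f: "fractional_linear f"
      "f A = Some 0" "f B = Some t" "f C = None" "f D = Some 1"
      "f E = proj_quot (t - 1) (t + 1)" "f F = Some (-1)"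
      unfolding R_configuration_def by blast
    define L where "L = (\<lambda>i::nat. if i = 1 then A else if i = 2 then B else if i = 3 then C
      else if i = 4 then D else if i = 5 then E else F)"
    have I: "{1..6} = {1, 2, 3, 4, 5, 6::nat}" by auto
    have L: "bij_betw L {1..6} \<Gamma>"
    proof -
      have "L ` {1..6} = \<Gamma>" unfolding I G by (auto simp: L_def)
      then show ?thesis
        unfolding bij_betw_def using assms(3) by (auto intro: eq_card_imp_inj_on)
    qed
    \<comment> \<open>The relabelling that makes point \<open>p i\<close> the \<open>i\<close>-th of
      A to F; outside the index set it is the identity, as \<open>permutes\<close> demands.\<close>
    define p where "p = (\<lambda>i. if i \<in> {1..6} then inv_into {1..6} P (L i) else i)"
    have "bij_betw p {1..6} {1..6}"
      using bij_betw_trans[OF L bij_betw_inv_into[OF P]]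
      by (rule bij_betw_cong[THEN iffD1, rotated]) (simp add: p_def)
    then have p: "p permutes {1..6}"
      by (rule bij_imp_permutes) (auto simp: p_def)
    have PL: "P (p i) = L i" if "i \<in> {1..6}" for i
      using that L P by (auto simp: p_def bij_betw_def intro!: f_inv_into_f)
    have "ricochet (joubert (\<alpha> \<circ> p) (\<beta> \<circ> p))"
      unfolding perm(2)[OF p] using f
      by (intro exI[of _ t] exI[of _ f]) (simp add: PL del: One_nat_def, simp add: L_def)
    then show "U6 \<Phi> = 0 \<and> U10 \<Phi> = 0"
      unfolding perm(1)[OF p] using perm(3)[OF p] unfolding joubert_relations_def
      by (blast intro: ricochet_imp_relations)
  next
    assume "U6 \<Phi> = 0 \<and> U10 \<Phi> = 0"
    then have "rel6 (joubert \<alpha> \<beta>) = 0" "rel10 (joubert \<alpha> \<beta>) = 0"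
      using U_eq_0_iff[OF nz \<Phi>(1)] by auto
    then obtain q where q: "q permutes {1..6}" "ricochet (joubert \<alpha> \<beta> \<circ> q)"
      using relations_imp_ricochet[of "joubert \<alpha> \<beta>"] joubert_relations[of \<alpha> \<beta>, OF nz]
      unfolding joubert_relations_def by blast
    \<comment> \<open>The reordering \<open>q\<close> of the coordinates comes from a relabelling
      \<open>p\<close> of the points.\<close>
    obtain p c where p: "p permutes {1..6}" and "c \<noteq> 0" and
      c: "\<And>i. i \<in> {1..6} \<Longrightarrow> joubert (\<alpha> \<circ> p) (\<beta> \<circ> p) i = c * joubert \<alpha> \<beta> (q i)"
      using joubert_realizable_permutes[OF q(1)] unfolding joubert_realizable_def by blast
    have "ricochet (\<lambda>i. c * (joubert \<alpha> \<beta> \<circ> q) i)"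
      using ricochet_scale[OF \<open>c \<noteq> 0\<close>] q(2) by blast
    then have "ricochet (joubert (\<alpha> \<circ> p) (\<beta> \<circ> p))"
      unfolding ricochet_def by (simp add: c del: One_nat_def)
    then obtain t f where f: "fractional_linear f" "f (P (p 1)) = Some 0" "f (P (p 2)) = Some t"
      "f (P (p 3)) = None" "f (P (p 4)) = Some 1" "f (P (p 5)) = proj_quot (t - 1) (t + 1)"
      "f (P (p 6)) = Some (-1)"
      unfolding perm(2)[OF p] by blast
    have "\<Gamma> = P ` p ` {1..6}"
      using P unfolding bij_betw_def permutes_image[OF p] by simp
    also have "{1..6} = {1, 2, 3, 4, 5, 6::nat}" by auto
    finally have "\<Gamma> = {P (p 1), P (p 2), P (p 3), P (p 4), P (p 5), P (p 6)}" by simp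
    with f assms(3) show "R_configuration \<Gamma>"
      unfolding R_configuration_def by blast
  qed
qed

end
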